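(* Let $K$ be an algebraically closed field of characteristic $\neq 2$, and let $E\subset\mathbb{P}^1\times\mathbb{P}^1$ be the closed subset defined by an irreducible bi-homogeneous form $F$ of bi-degree $(2,2)$ over $K$, such that $E$ is nonsingular (so that $E$ has genus $1$). Then there exists an automorphism $f$ of the first factor $\mathbb{P}^1$ such that the new embedding $$E\subset\mathbb{P}^1\times\mathbb{P}^1\stackrel{f\times 1}{\longrightarrow}\mathbb{P}^1\times\mathbb{P}^1$$ is symmetric.
   Context: An embedding $E\subset\mathbb{P}^1\times\mathbb{P}^1$ is called symmetric if $(p,q)\in E\Rightarrow (q,p)\in E$ (i.e. the image of $E$ is stable under interchanging the two factors). *)

theory Defs
  imports
    "HOL-Analysis.Analysis"
    "HOL-Computational_Algebra.Computational_Algebra"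
    "HOL-Library.Poly_Mapping"
begin

section \<open>Polynomials in finitely many variables\<close>

text \<open>
  A polynomial over \<open>'a\<close> with variables indexed by \<open>'v\<close> is a finitely supported map from
  exponent vectors to coefficients; \<open>HOL-Library.Poly_Mapping\<close> makes this type a commutative
  ring, so the library predicate \<^const>\<open>irreducible\<close> applies to it.
\<close>

type_synonym ('v, 'a) mpoly = "('v \<Rightarrow>\<^sub>0 nat) \<Rightarrow>\<^sub>0 'a"

definition mpoly_eval :: "('v::finite, 'a::comm_semiring_1) mpoly \<Rightarrow> ('v \<Rightarrow> 'a) \<Rightarrow> 'a" where
  "mpoly_eval p x =
     (\<Sum>m\<in>Poly_Mapping.keys p.
        Poly_Mapping.lookup p m * (\<Prod>v\<in>UNIV. x v ^ Poly_Mapping.lookup m v))"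

definition mpoly_deriv :: "'v::finite \<Rightarrow> ('v, 'a::comm_semiring_1) mpoly \<Rightarrow> ('v, 'a) mpoly" where
  "mpoly_deriv v p =
     (\<Sum>m\<in>Poly_Mapping.keys p.
        Poly_Mapping.single (m - Poly_Mapping.single v 1)
          (of_nat (Poly_Mapping.lookup m v) * Poly_Mapping.lookup p m))"

definition homogeneous :: "nat \<Rightarrow> ('v::finite, 'a::zero) mpoly \<Rightarrow> bool" where
  "homogeneous d p \<longleftrightarrow>
     (\<forall>m\<in>Poly_Mapping.keys p. (\<Sum>v\<in>UNIV. Poly_Mapping.lookup m v) = d)"

text \<open>
  The bi-graded ring \<open>K[x\<^sub>1, x\<^sub>2, y\<^sub>1, y\<^sub>2]\<close>: the variable \<open>Inl i\<close> is the coordinate \<open>x\<^sub>i\<close> of the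
  first factor and \<open>Inr j\<close> the coordinate \<open>y\<^sub>j\<close> of the second. The numeral type \<open>2\<close> has
  the two elements \<open>1\<close> and \<open>2\<close>.
\<close>

type_synonym 'a bipoly = "(2 + 2, 'a) mpoly"

definition bihomogeneous :: "nat \<Rightarrow> nat \<Rightarrow> 'a::zero bipoly \<Rightarrow> bool" where
  "bihomogeneous d e F \<longleftrightarrow>
     (\<forall>m\<in>Poly_Mapping.keys F.
        (\<Sum>i\<in>UNIV. Poly_Mapping.lookup m (Inl i)) = d \<and>
        (\<Sum>j\<in>UNIV. Poly_Mapping.lookup m (Inr j)) = e)"

definition bipoly_eval :: "'a::comm_semiring_1 bipoly \<Rightarrow> 'a ^ 2 \<Rightarrow> 'a ^ 2 \<Rightarrow> 'a" where
  "bipoly_eval F x y = mpoly_eval F (case_sum (($) x) (($) y))"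


section \<open>The projective line\<close>

definition proj_rel :: "'a::field ^ 2 \<Rightarrow> 'a ^ 2 \<Rightarrow> bool" where
  "proj_rel x y \<longleftrightarrow> x \<noteq> 0 \<and> y \<noteq> 0 \<and> (\<exists>c. c \<noteq> 0 \<and> y = c *s x)"

lemma part_equivp_proj_rel: "part_equivp (proj_rel :: 'a::field ^ 2 \<Rightarrow> _)"
proof (rule part_equivpI)
  have "(1 :: 'a ^ 2) \<noteq> 0" by (simp add: vec_eq_iff)
  then have "proj_rel (1 :: 'a ^ 2) 1"
    unfolding proj_rel_def by (metis vector_smult_lid zero_neq_one)
  then show "\<exists>x :: 'a ^ 2. proj_rel x x" by blast
  show "symp (proj_rel :: 'a ^ 2 \<Rightarrow> _)"
  proof (rule sympI)
    fix x y :: "'a ^ 2"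
    assume "proj_rel x y"
    then obtain c where c: "x \<noteq> 0" "y \<noteq> 0" "c \<noteq> 0" "y = c *s x"
      unfolding proj_rel_def by blast
    then have "inverse c \<noteq> 0 \<and> x = inverse c *s y"
      by (simp add: vector_smult_assoc)
    with c show "proj_rel y x" unfolding proj_rel_def by blast
  qed
  show "transp (proj_rel :: 'a ^ 2 \<Rightarrow> _)"
    by (rule transpI)
       (auto simp: proj_rel_def vector_smult_assoc intro: exI[where x = "_ * _"])
qed

quotient_type (overloaded) 'a p1 = "('a::field) ^ 2" / partial: proj_rel
  by (rule part_equivp_proj_rel)

text \<open>
  \<open>p1_pt x\<close> is the point with homogeneous coordinates \<open>[x\<^sub>1 : x\<^sub>2]\<close>. It is meaningful only for
  \<open>x \<noteq> 0\<close>, and every use below is guarded accordingly.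
\<close>

definition p1_pt :: "'a::field ^ 2 \<Rightarrow> 'a p1" where
  "p1_pt = abs_p1"

lemma p1_pt_eq_iff:
  assumes "x \<noteq> 0" "y \<noteq> 0"
  shows "p1_pt x = p1_pt y \<longleftrightarrow> (\<exists>c. c \<noteq> 0 \<and> y = c *s x)"
proof -
  have "proj_rel z z" if "z \<noteq> 0" for z :: "'a ^ 2"
    unfolding proj_rel_def using that by (metis vector_smult_lid zero_neq_one)
  with assms have "p1_pt x = p1_pt y \<longleftrightarrow> proj_rel x y"
    unfolding p1_pt_def using Quotient_rel[OF Quotient_p1, of x y] by auto
  with assms show ?thesis by (simp add: proj_rel_def)
qed

lemma p1_pt_cases:
  obtains x where "x \<noteq> 0" "p = p1_pt x"
  using Quotient_abs_rep[OF Quotient_p1, of p] Quotient_rep_reflp[OF Quotient_p1, of p]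
  unfolding p1_pt_def proj_rel_def by metis

text \<open>
  A morphism from the projective line to itself is given by two forms of the same degree without
  a common zero.
\<close>

definition p1_morphism :: "('a::field p1 \<Rightarrow> 'a p1) \<Rightarrow> bool" where
  "p1_morphism f \<longleftrightarrow>
     (\<exists>d (P :: (2, 'a) mpoly) (Q :: (2, 'a) mpoly).
        homogeneous d P \<and> homogeneous d Q \<and>
        (\<forall>x. x \<noteq> 0 \<longrightarrow>
           vector [mpoly_eval P (($) x), mpoly_eval Q (($) x)] \<noteq> (0 :: 'a ^ 2) \<and>
           f (p1_pt x) = p1_pt (vector [mpoly_eval P (($) x), mpoly_eval Q (($) x)])))"

definition p1_automorphism :: "('a::field p1 \<Rightarrow> 'a p1) \<Rightarrow> bool" where
  "p1_automorphism f \<longleftrightarrow> bij f \<and> p1_morphism f \<and> p1_morphism (inv f)"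


section \<open>Curves in the product of two projective lines\<close>

definition biproj_zeros :: "'a::field bipoly \<Rightarrow> ('a p1 \<times> 'a p1) set" where
  "biproj_zeros F = {(p1_pt x, p1_pt y) | x y. x \<noteq> 0 \<and> y \<noteq> 0 \<and> bipoly_eval F x y = 0}"

definition vanishing_ideal :: "('a::field p1 \<times> 'a p1) set \<Rightarrow> 'a bipoly set" where
  "vanishing_ideal E =
     {G. \<forall>x y. x \<noteq> 0 \<longrightarrow> y \<noteq> 0 \<longrightarrow> (p1_pt x, p1_pt y) \<in> E \<longrightarrow> bipoly_eval G x y = 0}"

definition bipoly_gradient :: "'a::field bipoly \<Rightarrow> 'a ^ 2 \<Rightarrow> 'a ^ 2 \<Rightarrow> 'a ^ (2 + 2)" where
  "bipoly_gradient G x y = (\<chi> v. bipoly_eval (mpoly_deriv v G) x y)"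

text \<open>
  Jacobian criterion for a curve \<open>E\<close>: at every point the Jacobian matrix of the full (reduced)
  ideal of \<open>E\<close> has rank equal to the codimension, which is \<open>1\<close>. The matrix is taken in
  homogeneous coordinates, i.e. on the cone over \<open>E\<close> in affine 4-space; away from \<open>x = 0\<close> and
  \<open>y = 0\<close> that cone is locally the product of \<open>E\<close> with two punctured lines, so it has the same
  codimension and the same singular points.
\<close>

definition nonsingular_curve :: "('a::field p1 \<times> 'a p1) set \<Rightarrow> bool" where
  "nonsingular_curve E \<longleftrightarrow>
     (\<forall>x y. x \<noteq> 0 \<longrightarrow> y \<noteq> 0 \<longrightarrow> (p1_pt x, p1_pt y) \<in> E \<longrightarrow>
        vec.dim {bipoly_gradient G x y | G. G \<in> vanishing_ideal E} = 1)"

end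

theory Submission
  imports Defs
begin

text \<open>
  Write \<open>F\<close> as a quadratic form in \<open>x\<close> whose coefficients are quadratic forms in \<open>y\<close>. Its
  discriminant \<open>D\<close> in \<open>x\<close> is a quartic in \<open>y\<close>, and a double root of \<open>D\<close> forces a singular point,
  so coordinates of the second line can be chosen in which \<open>D\<close> is even. On the level of binary
  quadratic forms with the discriminant as scalar product, \<open>F\<close> is a linear map, and evenness of
  \<open>D\<close> says that \<open>y\<^sub>1 y\<^sub>2\<close> and its orthogonal complement have orthogonal images. Coordinates
  of the first line adapted to the image \<open>w\<close> of \<open>y\<^sub>1 y\<^sub>2\<close> then leave in \<open>F\<close> only the monomial
  \<open>x\<^sub>1 x\<^sub>2 y\<^sub>1 y\<^sub>2\<close> and the products of squares, and rescaling \<open>x\<^sub>1\<close> (possibly after exchanging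
  \<open>x\<^sub>1\<close> and \<open>x\<^sub>2\<close>) makes this form symmetric.

  Singular points in this argument are singular points of \<open>F\<close>, whereas nonsingularity of \<open>E\<close> is
  about all polynomials \<open>G\<close> that vanish on \<open>E\<close>. In place of the Nullstellensatz, \<open>G\<close> is restricted to an
  affine plane through a singular point of \<open>F\<close> and divided by \<open>F\<close> there.
\<close>

no_notation fps_nth (infixl \<open>$\<close> 75)

declare One_nat_def [simp del]


section \<open>Biquadratic forms\<close>

definition binary_quadratic :: "'a::comm_ring_1 \<Rightarrow> 'a \<Rightarrow> 'a \<Rightarrow> 'a \<Rightarrow> 'a \<Rightarrow> 'a" where
  "binary_quadratic a b c u v = a * u^2 + b * u * v + c * v^2"

text \<open>Entry \<open>A i j\<close> is the coefficient of
  \<open>x1^(2-i) x2^i y1^(2-j) y2^j\<close>. The coefficients may lie in any commutative ring,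
  because the same formula serves over the field and over the polynomial ring that contains
  \<open>F\<close>.\<close>

definition biquadratic :: "(nat \<Rightarrow> nat \<Rightarrow> 'a::comm_ring_1) \<Rightarrow> 'a \<Rightarrow> 'a \<Rightarrow> 'a \<Rightarrow> 'a \<Rightarrow> 'a" where
  "biquadratic A x1 x2 y1 y2 =
     binary_quadratic (binary_quadratic (A 0 0) (A 0 1) (A 0 2) y1 y2)
       (binary_quadratic (A 1 0) (A 1 1) (A 1 2) y1 y2)
       (binary_quadratic (A 2 0) (A 2 1) (A 2 2) y1 y2) x1 x2"

lemmas biquadratic_expand = biquadratic_def binary_quadratic_def

definition transposed :: "(nat \<Rightarrow> nat \<Rightarrow> 'a) \<Rightarrow> nat \<Rightarrow> nat \<Rightarrow> 'a" where
  "transposed A i j = A j i"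

text \<open>The matrix has rows \<open>(e, f)\<close> and \<open>(g, h)\<close>. The new
  coefficients are written out because discriminants and normal forms are computed from
  them.\<close>

definition subst_y :: "'a \<Rightarrow> 'a \<Rightarrow> 'a \<Rightarrow> 'a \<Rightarrow> (nat \<Rightarrow> nat \<Rightarrow> 'a::comm_ring_1) \<Rightarrow> nat \<Rightarrow> nat \<Rightarrow> 'a" where
  "subst_y e f g h A i j =
     (if j = 0 then A i 0 * e^2 + A i 1 * e * g + A i 2 * g^2
      else if j = 1 then 2 * A i 0 * e * f + A i 1 * (e * h + f * g) + 2 * A i 2 * g * h
      else A i 0 * f^2 + A i 1 * f * h + A i 2 * h^2)"

definition subst_x :: "'a \<Rightarrow> 'a \<Rightarrow> 'a \<Rightarrow> 'a \<Rightarrow> (nat \<Rightarrow> nat \<Rightarrow> 'a::comm_ring_1) \<Rightarrow> nat \<Rightarrow> nat \<Rightarrow> 'a" where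
  "subst_x e f g h A = transposed (subst_y e f g h (transposed A))"

text \<open>The coefficients of the discriminant of the form with respect to \<open>x\<close>, a quartic in \<open>y\<close>.\<close>

definition disc_coeff :: "(nat \<Rightarrow> nat \<Rightarrow> 'a::comm_ring_1) \<Rightarrow> nat \<Rightarrow> 'a" where
  "disc_coeff A k =
     (if k = 0 then A 1 0 ^ 2 - 4 * A 0 0 * A 2 0
      else if k = 1 then 2 * A 1 0 * A 1 1 - 4 * (A 0 0 * A 2 1 + A 0 1 * A 2 0)
      else if k = 2 then A 1 1 ^ 2 + 2 * A 1 0 * A 1 2
        - 4 * (A 0 0 * A 2 2 + A 0 1 * A 2 1 + A 0 2 * A 2 0)
      else if k = 3 then 2 * A 1 1 * A 1 2 - 4 * (A 0 1 * A 2 2 + A 0 2 * A 2 1)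
      else A 1 2 ^ 2 - 4 * A 0 2 * A 2 2)"

text \<open>
  If \<open>2\<close> is invertible, a binary quadratic form and its gradient vanish at a point iff the point is a
  double root; this form of the Jacobian criterion is visibly invariant under coordinate changes.
\<close>

definition singular_at :: "(nat \<Rightarrow> nat \<Rightarrow> 'a::comm_ring_1) \<Rightarrow> 'a \<Rightarrow> 'a \<Rightarrow> 'a \<Rightarrow> 'a \<Rightarrow> bool" where
  "singular_at A x1 x2 y1 y2 \<longleftrightarrow>
     (\<exists>c. \<forall>u v. biquadratic A u v y1 y2 = c * (u * x2 - v * x1)^2) \<and>
     (\<exists>c. \<forall>u v. biquadratic A x1 x2 u v = c * (u * y2 - v * y1)^2)"

text \<open>The last two conditions say that the curve contains no fibre of either
  projection.\<close>

definition smooth :: "(nat \<Rightarrow> nat \<Rightarrow> 'a::comm_ring_1) \<Rightarrow> bool" where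
  "smooth A \<longleftrightarrow>
     (\<forall>x1 x2 y1 y2. (x1, x2) \<noteq> (0, 0) \<longrightarrow> (y1, y2) \<noteq> (0, 0) \<longrightarrow> \<not> singular_at A x1 x2 y1 y2) \<and>
     (\<forall>y1 y2. (y1, y2) \<noteq> (0, 0) \<longrightarrow> (\<exists>u v. biquadratic A u v y1 y2 \<noteq> 0)) \<and>
     (\<forall>x1 x2. (x1, x2) \<noteq> (0, 0) \<longrightarrow> (\<exists>u v. biquadratic A x1 x2 u v \<noteq> 0))"

text \<open>The two lines get independent coordinate changes; composing one with the inverse of the
  other later yields the automorphism of the first line alone.\<close>

definition symmetrizable :: "(nat \<Rightarrow> nat \<Rightarrow> 'a::comm_ring_1) \<Rightarrow> bool" where
  "symmetrizable A \<longleftrightarrow> (\<exists>e f g h e' f' g' h'. e * h - f * g \<noteq> 0 \<and> e' * h' - f' * g' \<noteq> 0 \<and>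
     (\<forall>x1 x2 y1 y2.
        biquadratic A (e * x1 + f * x2) (g * x1 + h * x2) (e' * y1 + f' * y2) (g' * y1 + h' * y2) =
        biquadratic A (e * y1 + f * y2) (g * y1 + h * y2) (e' * x1 + f' * x2) (g' * x1 + h' * x2)))"

section \<open>Exchange of the two factors and linear coordinate changes\<close>

lemma biquadratic_transposed:
  "biquadratic (transposed A) x1 x2 y1 y2 = biquadratic A y1 y2 x1 x2"
  by (simp add: biquadratic_expand transposed_def algebra_simps)

lemma biquadratic_subst_y:
  "biquadratic (subst_y e f g h A) x1 x2 y1 y2 =
     biquadratic A x1 x2 (e * y1 + f * y2) (g * y1 + h * y2)"
proof -
  have "binary_quadratic (subst_y e f g h A i 0) (subst_y e f g h A i 1) (subst_y e f g h A i 2) y1 y2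
     = binary_quadratic (A i 0) (A i 1) (A i 2) (e * y1 + f * y2) (g * y1 + h * y2)" for i
    by (simp add: binary_quadratic_def subst_y_def algebra_simps power2_eq_square)
  then show ?thesis by (simp add: biquadratic_def)
qed

lemma biquadratic_subst_x:
  "biquadratic (subst_x e f g h A) x1 x2 y1 y2 =
     biquadratic A (e * x1 + f * x2) (g * x1 + h * x2) y1 y2"
  by (simp add: subst_x_def biquadratic_transposed biquadratic_subst_y)

lemma smooth_transposed:
  fixes A :: "nat \<Rightarrow> nat \<Rightarrow> 'a::comm_ring_1"
  shows "smooth (transposed A) \<longleftrightarrow> smooth A"
proof -
  have sing: "singular_at (transposed A) x1 x2 y1 y2 \<longleftrightarrow> singular_at A y1 y2 x1 x2"
    for x1 x2 y1 y2 and A :: "nat \<Rightarrow> nat \<Rightarrow> 'a"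
    unfolding singular_at_def biquadratic_transposed by (rule conj_commute)
  have imp: "smooth (transposed A)" if "smooth A" for A :: "nat \<Rightarrow> nat \<Rightarrow> 'a"
    using that unfolding smooth_def biquadratic_transposed sing
    by (elim conjE, intro conjI; (assumption | iprover))
  have "transposed (transposed A) = A" by (simp add: transposed_def fun_eq_iff)
  with imp[of A] imp[of "transposed A"] show ?thesis by auto
qed

lemma linear_inverse:
  fixes e f g h :: "'a::field"
  assumes "e * h - f * g \<noteq> 0"
  defines "d \<equiv> e * h - f * g"
  shows "e * ((h * u - f * v) / d) + f * ((e * v - g * u) / d) = u"
    and "g * ((h * u - f * v) / d) + h * ((e * v - g * u) / d) = v"
proof -
  have d: "d \<noteq> 0" using assms by simp
  have "(e * (h * u - f * v) + f * (e * v - g * u)) = u * d"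
    and "(g * (h * u - f * v) + h * (e * v - g * u)) = v * d"
    by (simp_all add: d_def algebra_simps)
  then show "e * ((h * u - f * v) / d) + f * ((e * v - g * u) / d) = u"
    and "g * ((h * u - f * v) / d) + h * ((e * v - g * u) / d) = v"
    using d by (metis add_divide_distrib nonzero_mult_div_cancel_right times_divide_eq_right)+
qed

lemma linear_kernel:
  fixes e f g h :: "'a::field"
  assumes "e * h - f * g \<noteq> 0" "e * u + f * v = 0" "g * u + h * v = 0"
  shows "u = 0" "v = 0"
proof -
  have "(e * h - f * g) * u = h * (e * u + f * v) - f * (g * u + h * v)"
    and "(e * h - f * g) * v = e * (g * u + h * v) - g * (e * u + f * v)"
    by (simp_all add: algebra_simps)
  then have "(e * h - f * g) * u = 0" "(e * h - f * g) * v = 0"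
    by (simp_all only: assms(2,3) mult_zero_right diff_self)
  with assms(1) show "u = 0" "v = 0" by (simp_all only: mult_eq_0_iff simp_thms)
qed

lemma smooth_subst_y:
  fixes A :: "nat \<Rightarrow> nat \<Rightarrow> 'a::field"
  assumes A: "smooth A" and d: "e * h - f * g \<noteq> 0"
  shows "smooth (subst_y e f g h A)"
proof -
  define d where "d = e * h - f * g"
  have d0: "d \<noteq> 0" using d by (simp add: d_def)
  define p q where "p u v = (h * u - f * v) / d" and "q u v = (e * v - g * u) / d" for u v
  have inv: "e * p u v + f * q u v = u" "g * p u v + h * q u v = v" for u v
    using linear_inverse[OF d, of u v] by (simp_all add: p_def q_def d_def)
  have nz: "(e * u + f * v, g * u + h * v) \<noteq> (0, 0)" if "(u, v) \<noteq> (0, 0)" for u v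
    using linear_kernel[OF d, of u v] that by auto
  have sing: "singular_at A x1 x2 (e * y1 + f * y2) (g * y1 + h * y2)"
    if s: "singular_at (subst_y e f g h A) x1 x2 y1 y2" for x1 x2 y1 y2
  proof -
    obtain c where c: "\<And>u v. biquadratic (subst_y e f g h A) x1 x2 u v = c * (u * y2 - v * y1)^2"
      using s unfolding singular_at_def by blast
    \<comment> \<open>A coordinate change multiplies the alternating form
      \<open>u * y2 - v * y1\<close> by its determinant, hence the factor \<open>d^2\<close> for the
      square.\<close>
    have "biquadratic A x1 x2 u v = c / d^2 * (u * (g * y1 + h * y2) - v * (e * y1 + f * y2))^2" for u v
    proof -
      have "biquadratic A x1 x2 u v = c * (p u v * y2 - q u v * y1)^2"
        using c[of "p u v" "q u v"] by (simp add: biquadratic_subst_y inv)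
      also have "p u v * y2 - q u v * y1 = (u * (g * y1 + h * y2) - v * (e * y1 + f * y2)) / d"
        using d0 by (simp add: p_def q_def field_simps)
      finally show ?thesis by (simp add: power_divide)
    qed
    with s show ?thesis
      unfolding singular_at_def biquadratic_subst_y by blast
  qed
  show ?thesis
    unfolding smooth_def
  proof (intro conjI allI impI)
    fix x1 x2 y1 y2 :: 'a
    assume "(x1, x2) \<noteq> (0, 0)" "(y1, y2) \<noteq> (0, 0)"
    then show "\<not> singular_at (subst_y e f g h A) x1 x2 y1 y2"
      using A sing[of x1 x2 y1 y2] nz[of y1 y2] unfolding smooth_def by metis
  next
    fix y1 y2 :: 'a
    assume "(y1, y2) \<noteq> (0, 0)"
    then show "\<exists>u v. biquadratic (subst_y e f g h A) u v y1 y2 \<noteq> 0"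
      using A nz[of y1 y2] unfolding smooth_def biquadratic_subst_y by metis
  next
    fix x1 x2 :: 'a
    assume "(x1, x2) \<noteq> (0, 0)"
    then obtain u v where "biquadratic A x1 x2 u v \<noteq> 0"
      using A unfolding smooth_def by metis
    then have "biquadratic (subst_y e f g h A) x1 x2 (p u v) (q u v) \<noteq> 0"
      by (simp add: biquadratic_subst_y inv)
    then show "\<exists>u v. biquadratic (subst_y e f g h A) x1 x2 u v \<noteq> 0"
      by blast
  qed
qed

lemma smooth_subst_x:
  fixes A :: "nat \<Rightarrow> nat \<Rightarrow> 'a::field"
  assumes "smooth A" "e * h - f * g \<noteq> 0"
  shows "smooth (subst_x e f g h A)"
  using assms by (simp add: subst_x_def smooth_transposed smooth_subst_y)

lemma symmetrizable_transposed:
  assumes "symmetrizable (transposed A)"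
  shows "symmetrizable A"
proof -
  obtain e f g h e' f' g' h' where "e * h - f * g \<noteq> 0" "e' * h' - f' * g' \<noteq> 0"
    and "\<And>x1 x2 y1 y2.
        biquadratic A (e' * y1 + f' * y2) (g' * y1 + h' * y2) (e * x1 + f * x2) (g * x1 + h * x2) =
        biquadratic A (e' * x1 + f' * x2) (g' * x1 + h' * x2) (e * y1 + f * y2) (g * y1 + h * y2)"
    using assms unfolding symmetrizable_def biquadratic_transposed by blast
  then show ?thesis unfolding symmetrizable_def by metis
qed

lemma symmetrizable_subst_y:
  fixes A :: "nat \<Rightarrow> nat \<Rightarrow> 'a::idom"
  assumes "symmetrizable (subst_y p q r s A)" "p * s - q * r \<noteq> 0"
  shows "symmetrizable A"
proof -
  obtain e f g h e' f' g' h' where det: "e * h - f * g \<noteq> 0" "e' * h' - f' * g' \<noteq> 0"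
    and eq: "\<And>x1 x2 y1 y2.
        biquadratic (subst_y p q r s A) (e * x1 + f * x2) (g * x1 + h * x2) (e' * y1 + f' * y2) (g' * y1 + h' * y2) =
        biquadratic (subst_y p q r s A) (e * y1 + f * y2) (g * y1 + h * y2) (e' * x1 + f' * x2) (g' * x1 + h' * x2)"
    using assms unfolding symmetrizable_def by blast
  define e2 f2 g2 h2 where "e2 = p * e' + q * g'" and "f2 = p * f' + q * h'"
    and "g2 = r * e' + s * g'" and "h2 = r * f' + s * h'"
  have lin: "p * (e' * u + f' * v) + q * (g' * u + h' * v) = e2 * u + f2 * v"
    "r * (e' * u + f' * v) + s * (g' * u + h' * v) = g2 * u + h2 * v" for u v
    by (simp_all add: e2_def f2_def g2_def h2_def algebra_simps)
  have "e2 * h2 - f2 * g2 = (p * s - q * r) * (e' * h' - f' * g')"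
    by (simp add: e2_def f2_def g2_def h2_def algebra_simps)
  with det assms(2) have "e2 * h2 - f2 * g2 \<noteq> 0" by simp
  with det(1) eq show ?thesis
    unfolding symmetrizable_def biquadratic_subst_y lin by blast
qed

lemma symmetrizable_subst_x:
  fixes A :: "nat \<Rightarrow> nat \<Rightarrow> 'a::idom"
  assumes "symmetrizable (subst_x p q r s A)" "p * s - q * r \<noteq> 0"
  shows "symmetrizable A"
  using symmetrizable_transposed[OF assms(1)[unfolded subst_x_def], THEN symmetrizable_subst_y, OF assms(2)]
  by (rule symmetrizable_transposed)


section \<open>Normal forms of binary quadratic forms\<close>

lemma alg_closed_sqrt:
  fixes c :: "'a::alg_closed_field"
  obtains t where "t^2 = c"
  using nth_root_exists[of 2 c] by auto

text \<open>The form splits into two linear factors. Distinct factors become the two coordinates up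
  to scalars; a double factor becomes one coordinate.\<close>

lemma binary_quadratic_normal_form:
  fixes a b c :: "'a::alg_closed_field"
  assumes "(a, b, c) \<noteq> (0, 0, 0)"
  obtains e f g h k where "e * h - f * g \<noteq> 0" "k \<noteq> 0"
    "(\<forall>u v. binary_quadratic a b c (e * u + f * v) (g * u + h * v) = k * u * v) \<or>
     (\<forall>u v. binary_quadratic a b c (e * u + f * v) (g * u + h * v) = k * u^2)"
proof -
  consider "a \<noteq> 0" | "a = 0" "b \<noteq> 0" | "a = 0" "b = 0" "c \<noteq> 0" using assms by auto
  then show thesis
  proof cases
    case 1
    have "\<exists>t. poly [:c, b, a:] t = 0"
      by (rule alg_closed_imp_poly_has_root) (use 1 in simp)
    then obtain t where "c + t * (b + t * a) = 0" by auto
    then have c: "c = - (t * (b + t * a))" by (simp add: eq_neg_iff_add_eq_0)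
    \<comment> \<open>The second root of \<open>a * X^2 + b * X + c\<close>, obtained from the sum
      of the roots.\<close>
    define t' where "t' = - b / a - t"
    have b: "b = - a * (t + t')" using 1 by (simp add: t'_def field_simps)
    have c': "c = a * t * t'" unfolding c b by (simp add: algebra_simps)
    show thesis
    proof (cases "t = t'")
      case True
      have "binary_quadratic a b c (1 * u + t * v) (0 * u + 1 * v) = a * u^2" for u v
        unfolding binary_quadratic_def b c' True by (simp add: algebra_simps power2_eq_square)
      then show thesis using 1 that[of 1 1 t 0 a] by simp
    next
      case False
      \<comment> \<open>The columns of the substitution are the root vectors \<open>(t', 1)\<close>
        and \<open>- (t, 1)\<close>.\<close>
      have "binary_quadratic a b c (t' * u + (- t) * v) (1 * u + (- 1) * v) = a * (t' - t)^2 * u * v" for u v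
        unfolding binary_quadratic_def b c' by (simp add: algebra_simps power2_eq_square)
      then show thesis using 1 False that[of t' "-1" "-t" 1 "a * (t' - t)^2"] by simp
    qed
  next
    case 2
    have "binary_quadratic a b c (1 * u + (- c / b) * v) (0 * u + 1 * v) = b * u * v" for u v
      unfolding binary_quadratic_def using 2 by (simp add: field_simps power2_eq_square)
    then show thesis using 2 that[of 1 1 "- c / b" 0 b] by simp
  next
    case 3
    have "binary_quadratic a b c (0 * u + 1 * v) (1 * u + 0 * v) = c * u^2" for u v
      unfolding binary_quadratic_def using 3 by simp
    then show thesis using 3 that[of 0 0 1 1 c] by simp
  qed
qed


section \<open>Symmetrization of smooth biquadratic forms\<close>

lemma binary_quadratic_eqD:
  assumes "\<And>u v. binary_quadratic a b c u v = binary_quadratic a' b' c' u v"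
  shows "a = a'" "b = b'" "c = c'"
  using assms[of 1 0] assms[of 0 1] assms[of 1 1] by (simp_all add: binary_quadratic_def)

lemma subst_x_column:
  "binary_quadratic (subst_x e f g h A 0 j) (subst_x e f g h A 1 j) (subst_x e f g h A 2 j) u v =
     binary_quadratic (A 0 j) (A 1 j) (A 2 j) (e * u + f * v) (g * u + h * v)"
  by (simp add: binary_quadratic_def subst_x_def transposed_def subst_y_def algebra_simps power2_eq_square)

text \<open>The discriminant of a quadratic form is multiplied by the square of the determinant, so
  a vanishing odd coefficient stays zero.\<close>

lemma disc_coeff_subst_x:
  assumes "k \<in> {1, 3}"
  shows "disc_coeff (subst_x e f g h A) k = (e * h - f * g)^2 * disc_coeff A k"
proof -
  have "disc_coeff (subst_x e f g h A) 1 = (e * h - f * g)^2 * disc_coeff A 1"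
    unfolding disc_coeff_def subst_x_def transposed_def subst_y_def 
    by (simp add: algebra_simps power2_eq_square)
  moreover have "disc_coeff (subst_x e f g h A) 3 = (e * h - f * g)^2 * disc_coeff A 3"
    unfolding disc_coeff_def subst_x_def transposed_def subst_y_def 
    by (simp add: algebra_simps power2_eq_square)
  ultimately show ?thesis using assms by auto
qed

text \<open>\<open>disc_coeff A k\<close> belongs to \<open>y1^(4-k) y2^k\<close>, and the
  substitution is carried out in this quartic. Its new outer coefficients are its values at the
  columns \<open>(e, g)\<close> and \<open>(f, h)\<close>.\<close>

lemma disc_coeff_subst_y:
  shows "disc_coeff (subst_y e f g h A) 0 = e^4 * disc_coeff A 0 + e^3 * g * disc_coeff A 1
      + e^2 * g^2 * disc_coeff A 2 + e * g^3 * disc_coeff A 3 + g^4 * disc_coeff A 4"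
    and "disc_coeff (subst_y e f g h A) 1 = 4 * e^3 * f * disc_coeff A 0
      + (e^3 * h + 3 * e^2 * f * g) * disc_coeff A 1 + (2 * e^2 * g * h + 2 * e * f * g^2) * disc_coeff A 2
      + (3 * e * g^2 * h + f * g^3) * disc_coeff A 3 + 4 * g^3 * h * disc_coeff A 4"
    and "disc_coeff (subst_y e f g h A) 3 = 4 * f^3 * e * disc_coeff A 0
      + (f^3 * g + 3 * f^2 * e * h) * disc_coeff A 1 + (2 * f^2 * h * g + 2 * f * e * h^2) * disc_coeff A 2
      + (3 * f * h^2 * g + e * h^3) * disc_coeff A 3 + 4 * h^3 * g * disc_coeff A 4"
    and "disc_coeff (subst_y e f g h A) 4 = f^4 * disc_coeff A 0 + f^3 * h * disc_coeff A 1
      + f^2 * h^2 * disc_coeff A 2 + f * h^3 * disc_coeff A 3 + h^4 * disc_coeff A 4"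
  unfolding disc_coeff_def subst_y_def
  by (simp_all add: algebra_simps power2_eq_square power3_eq_cube power4_eq_xxxx)

lemma symmetrizableI:
  assumes "e * h - f * g \<noteq> 0" "e' * h' - f' * g' \<noteq> 0"
    and "\<And>x1 x2 y1 y2.
        biquadratic A (e * x1 + f * x2) (g * x1 + h * x2) (e' * y1 + f' * y2) (g' * y1 + h' * y2) =
        biquadratic A (e * y1 + f * y2) (g * y1 + h * y2) (e' * x1 + f' * x2) (g' * x1 + h' * x2)"
  shows "symmetrizable A"
  using assms unfolding symmetrizable_def by blast

text \<open>Only \<open>x1 x2 y1 y2\<close> and the products of squares occur, so symmetry means
  that \<open>A 0 2\<close> and \<open>A 2 0\<close> agree. Scaling \<open>x1\<close> by
  \<open>t\<close> multiplies the former by \<open>t^2\<close> and fixes the latter.\<close>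

lemma symmetrizable_even_nonzero:
  fixes A :: "nat \<Rightarrow> nat \<Rightarrow> 'a::alg_closed_field"
  assumes even: "A 0 1 = 0" "A 1 0 = 0" "A 1 2 = 0" "A 2 1 = 0"
    and nz: "A 0 2 \<noteq> 0" "A 2 0 \<noteq> 0"
  shows "symmetrizable A"
proof -
  obtain t where t: "t^2 = A 2 0 / A 0 2" by (rule alg_closed_sqrt)
  have t0: "t \<noteq> 0" using t nz by auto
  have t2: "t * (t * A 0 2) = A 2 0" using t nz by (simp add: power2_eq_square field_simps)
  have "biquadratic A (t * x1 + 0 * x2) (0 * x1 + 1 * x2) (1 * y1 + 0 * y2) (0 * y1 + 1 * y2) =
        biquadratic A (t * y1 + 0 * y2) (0 * y1 + 1 * y2) (1 * x1 + 0 * x2) (0 * x1 + 1 * x2)"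
    for x1 x2 y1 y2
    unfolding biquadratic_expand by (simp add: even t2[symmetric] algebra_simps power2_eq_square)
  with t0 show ?thesis
    by (intro symmetrizableI[of t 1 0 0 1 1 0 0]) simp_all
qed

lemma symmetrizable_even:
  fixes A :: "nat \<Rightarrow> nat \<Rightarrow> 'a::alg_closed_field"
  assumes even: "A 0 1 = 0" "A 1 0 = 0" "A 1 2 = 0" "A 2 1 = 0"
    and A: "smooth A"
  shows "symmetrizable A"
proof -
  have nz: "\<exists>u v. biquadratic A u v y1 y2 \<noteq> 0" "\<exists>u v. biquadratic A y1 y2 u v \<noteq> 0"
    if "(y1, y2) \<noteq> (0, 0)" for y1 y2
    using A that unfolding smooth_def by metis+
  \<comment> \<open>If one of these pairs vanished, the form would be zero on a whole fibre over a
    coordinate point.\<close>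
  have "(A 0 0, A 2 0) \<noteq> (0, 0)" "(A 0 0, A 0 2) \<noteq> (0, 0)" "(A 0 2, A 2 2) \<noteq> (0, 0)" "(A 2 0, A 2 2) \<noteq> (0, 0)"
    using nz[of 1 0] nz[of 0 1] by (auto simp: biquadratic_expand even)
  then consider "A 0 2 \<noteq> 0" "A 2 0 \<noteq> 0" | "A 0 2 = 0" "A 2 0 = 0" | "A 0 0 \<noteq> 0" "A 2 2 \<noteq> 0"
    by auto
  then show ?thesis
  proof cases
    case 1
    then show ?thesis using symmetrizable_even_nonzero even by blast
  next
    case 2
    have "biquadratic A (1 * x1 + 0 * x2) (0 * x1 + 1 * x2) (1 * y1 + 0 * y2) (0 * y1 + 1 * y2) =
        biquadratic A (1 * y1 + 0 * y2) (0 * y1 + 1 * y2) (1 * x1 + 0 * x2) (0 * x1 + 1 * x2)"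
      for x1 x2 y1 y2
      unfolding biquadratic_expand by (simp add: even 2 algebra_simps power2_eq_square)
    then show ?thesis
      by (intro symmetrizableI[of 1 1 0 0 1 1 0 0]) simp_all
  next
    case 3
    \<comment> \<open>Exchanging \<open>x1\<close> and \<open>x2\<close> moves \<open>A 0 0\<close>
      and \<open>A 2 2\<close> to the positions \<open>2 0\<close> and \<open>0 2\<close>.\<close>
    have "symmetrizable (subst_x 0 1 1 0 A)"
      by (rule symmetrizable_even_nonzero)
        (use 3 even in \<open>simp_all add: subst_x_def transposed_def subst_y_def\<close>)
    then show ?thesis by (rule symmetrizable_subst_x) simp
  qed
qed

text \<open>The case in which the image \<open>w\<close> of \<open>y1 y2\<close> is zero. The form
  is \<open>y1^2\<close> times one quadratic form in \<open>x\<close> plus \<open>y2^2\<close> times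
  another, and coordinates are needed in which both lack the mixed term.\<close>

lemma symmetrizable_no_middle:
  fixes A :: "nat \<Rightarrow> nat \<Rightarrow> 'a::alg_closed_field"
  assumes two: "(2::'a) \<noteq> 0" and mid: "A 0 1 = 0" "A 1 1 = 0" "A 2 1 = 0"
    and A: "smooth A"
  shows "symmetrizable A"
proof -
  have "\<exists>u v. biquadratic A u v 1 0 \<noteq> 0"
    using A unfolding smooth_def by (metis prod.inject zero_neq_one)
  then have "(A 0 0, A 1 0, A 2 0) \<noteq> (0, 0, 0)"
    by (auto simp: biquadratic_expand)
  then obtain e f g h k where d: "e * h - f * g \<noteq> 0" and k: "k \<noteq> 0" and
    nf: "(\<forall>u v. binary_quadratic (A 0 0) (A 1 0) (A 2 0) (e * u + f * v) (g * u + h * v) = k * u * v) \<or>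
     (\<forall>u v. binary_quadratic (A 0 0) (A 1 0) (A 2 0) (e * u + f * v) (g * u + h * v) = k * u^2)"
    by (rule binary_quadratic_normal_form)
  define B where "B = subst_x e f g h A"
  have B: "smooth B" using smooth_subst_x[OF A d] by (simp add: B_def)
  have midB: "B 0 1 = 0" "B 1 1 = 0" "B 2 1 = 0"
    using mid by (simp_all add: B_def subst_x_def transposed_def subst_y_def)
  have nz: "\<exists>u v. biquadratic B y1 y2 u v \<noteq> 0" if "(y1, y2) \<noteq> (0, 0)" for y1 y2
    using B that unfolding smooth_def by metis
  have "symmetrizable B"
    using nf
  proof
    assume "\<forall>u v. binary_quadratic (A 0 0) (A 1 0) (A 2 0) (e * u + f * v) (g * u + h * v) = k * u * v"
    then have "binary_quadratic (B 0 0) (B 1 0) (B 2 0) u v = binary_quadratic 0 k 0 u v" for u v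
      unfolding B_def subst_x_column by (simp add: binary_quadratic_def)
    note col = binary_quadratic_eqD[OF this]
    have B02: "B 0 2 \<noteq> 0" and B22: "B 2 2 \<noteq> 0"
      using nz[of 1 0] nz[of 0 1] col midB by (auto simp: biquadratic_expand)
    \<comment> \<open>With \<open>x1 = t * (u + v)\<close> and \<open>x2 = u - v\<close> the product
      \<open>x1 x2\<close> becomes \<open>t * (u^2 - v^2)\<close>, and this \<open>t\<close> makes
      the mixed terms of the two squares cancel.\<close>
    obtain t where t: "t^2 = B 2 2 / B 0 2" by (rule alg_closed_sqrt)
    have t0: "t \<noteq> 0" using t B02 B22 by auto
    have t2: "B 2 2 = B 0 2 * t^2" using t B02 by simp
    have det: "t * (- 1) - t * 1 \<noteq> 0"
    proof -
      have "t * (- 1) - t * 1 = - (2 * t)" by simp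
      then show ?thesis using two t0 by (metis mult_eq_0_iff neg_equal_0_iff_equal)
    qed
    have "symmetrizable (subst_x t t 1 (-1) B)"
      by (rule symmetrizable_even[OF _ _ _ _ smooth_subst_x[OF B det]])
        (simp_all add: subst_x_def transposed_def subst_y_def col midB t2 power2_eq_square)
    then show ?thesis using det by (rule symmetrizable_subst_x)
  next
    assume "\<forall>u v. binary_quadratic (A 0 0) (A 1 0) (A 2 0) (e * u + f * v) (g * u + h * v) = k * u^2"
    then have "binary_quadratic (B 0 0) (B 1 0) (B 2 0) u v = binary_quadratic k 0 0 u v" for u v
      unfolding B_def subst_x_column by (simp add: binary_quadratic_def)
    note col = binary_quadratic_eqD[OF this]
    have B22: "B 2 2 \<noteq> 0"
      using nz[of 0 1] col midB by (auto simp: biquadratic_expand)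
    \<comment> \<open>Completes the square in the column of \<open>y2^2\<close>; the column
      \<open>k * x1^2\<close> is unchanged because \<open>x1\<close> is kept.\<close>
    define s where "s = B 1 2 / (2 * B 2 2)"
    have s: "B 1 2 = 2 * B 2 2 * s" using two B22 by (simp add: s_def)
    have "symmetrizable (subst_x 1 0 (-s) 1 B)"
      by (rule symmetrizable_even[OF _ _ _ _ smooth_subst_x[OF B]])
        (simp_all add: subst_x_def transposed_def subst_y_def col midB s)
    then show ?thesis by (rule symmetrizable_subst_x) simp
  qed
  then show ?thesis using d unfolding B_def by (rule symmetrizable_subst_x)
qed

text \<open>The odd coefficients of the quartic pair the middle column \<open>w\<close> with the two
  outer columns under the polar form of the discriminant. Their vanishing is therefore the
  orthogonality to be exploited.\<close>

lemma symmetrizable_disc_even: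
  fixes A :: "nat \<Rightarrow> nat \<Rightarrow> 'a::alg_closed_field"
  assumes two: "(2::'a) \<noteq> 0" and disc: "disc_coeff A 1 = 0" "disc_coeff A 3 = 0"
    and A: "smooth A"
  shows "symmetrizable A"
proof (cases "(A 0 1, A 1 1, A 2 1) = (0, 0, 0)")
  case True
  then show ?thesis using symmetrizable_no_middle[OF two _ _ _ A] by simp
next
  case False
  then obtain e f g h k where d: "e * h - f * g \<noteq> 0" and k: "k \<noteq> 0" and
    nf: "(\<forall>u v. binary_quadratic (A 0 1) (A 1 1) (A 2 1) (e * u + f * v) (g * u + h * v) = k * u * v) \<or>
     (\<forall>u v. binary_quadratic (A 0 1) (A 1 1) (A 2 1) (e * u + f * v) (g * u + h * v) = k * u^2)"
    by (rule binary_quadratic_normal_form)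
  define B where "B = subst_x e f g h A"
  have B: "smooth B" using smooth_subst_x[OF A d] by (simp add: B_def)
  have discB: "disc_coeff B 1 = 0" "disc_coeff B 3 = 0"
    using disc by (simp_all add: B_def disc_coeff_subst_x)
  have four: "(4::'a) \<noteq> 0"
    using two by (metis mult_eq_0_iff numeral_Bit0 mult_2)
  have "symmetrizable B"
    using nf
  proof
    assume "\<forall>u v. binary_quadratic (A 0 1) (A 1 1) (A 2 1) (e * u + f * v) (g * u + h * v) = k * u * v"
    then have "binary_quadratic (B 0 1) (B 1 1) (B 2 1) u v = binary_quadratic 0 k 0 u v" for u v
      unfolding B_def subst_x_column by (simp add: binary_quadratic_def)
    note col = binary_quadratic_eqD[OF this]
    have "B 1 0 = 0" "B 1 2 = 0"
      using discB two k by (simp_all add: disc_coeff_def col)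
    then show ?thesis using symmetrizable_even[OF _ _ _ _ B] col by simp
  next
    assume "\<forall>u v. binary_quadratic (A 0 1) (A 1 1) (A 2 1) (e * u + f * v) (g * u + h * v) = k * u^2"
    then have "binary_quadratic (B 0 1) (B 1 1) (B 2 1) u v = binary_quadratic k 0 0 u v" for u v
      unfolding B_def subst_x_column by (simp add: binary_quadratic_def)
    note col = binary_quadratic_eqD[OF this]
    \<comment> \<open>If \<open>w\<close> is a square, orthogonality removes all terms in
      \<open>x2^2\<close>, so that the curve contains the fibre over \<open>(0, 1)\<close>.\<close>
    have "B 2 0 = 0" "B 2 2 = 0"
      using discB four k by (simp_all add: disc_coeff_def col)
    then have "biquadratic B 0 1 u v = 0" for u v
      by (simp add: biquadratic_expand col)
    moreover have "\<exists>u v. biquadratic B 0 1 u v \<noteq> 0"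
      using B unfolding smooth_def by (metis prod.inject zero_neq_one)
    ultimately show ?thesis by blast
  qed
  then show ?thesis using d unfolding B_def by (rule symmetrizable_subst_x)
qed

text \<open>Over a root \<open>(1, 0)\<close> of the discriminant the form has a double root
  \<open>s\<close> in \<open>x\<close>. The derivative of the discriminant at this root is
  \<open>-4 * c\<close> times the derivative of the form at \<open>s\<close> in the direction of
  \<open>y2\<close>, so a multiple root produces a singular point.\<close>

lemma smooth_disc_simple_root:
  fixes A :: "nat \<Rightarrow> nat \<Rightarrow> 'a::alg_closed_field"
  assumes two: "(2::'a) \<noteq> 0" and A: "smooth A" and disc: "disc_coeff A 0 = 0"
  shows "disc_coeff A 1 \<noteq> 0"
proof
  assume disc1: "disc_coeff A 1 = 0"
  have four: "(4::'a) \<noteq> 0"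
    using two by (metis mult_eq_0_iff numeral_Bit0 mult_2)
  have "\<exists>c s1 s2. (s1, s2) \<noteq> (0, 0) \<and> A 0 0 = c * s2^2 \<and> A 1 0 = - 2 * c * s1 * s2 \<and> A 2 0 = c * s1^2"
  proof (cases "A 0 0 = 0")
    case True
    then have "A 1 0 = 0" using disc by (simp add: disc_coeff_def)
    \<comment> \<open>Here the double root lies at infinity, \<open>s = (1, 0)\<close>.\<close>
    with True show ?thesis by (intro exI[of _ "A 2 0"] exI[of _ 1] exI[of _ 0]) simp
  next
    case False
    define s where "s = - A 1 0 / (2 * A 0 0)"
    have s: "A 1 0 = - 2 * A 0 0 * s" using False two by (simp add: s_def)
    have "4 * A 0 0 * (A 2 0 - A 0 0 * s^2) = 0"
      using disc unfolding disc_coeff_def s by (auto simp add: algebra_simps power2_eq_square)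
    then have "A 2 0 = A 0 0 * s^2" using False four by simp
    with s show ?thesis by (intro exI[of _ "A 0 0"] exI[of _ s] exI[of _ 1]) simp
  qed
  then obtain c s1 s2 where s: "(s1, s2) \<noteq> (0, 0)" "A 0 0 = c * s2^2" "A 1 0 = - 2 * c * s1 * s2"
    "A 2 0 = c * s1^2" by blast
  have f: "biquadratic A u v 1 0 = c * (u * s2 - v * s1)^2" for u v
    by (simp add: biquadratic_expand s algebra_simps power2_eq_square)
  have "\<exists>u v. biquadratic A u v 1 0 \<noteq> 0"
    using A unfolding smooth_def by (metis prod.inject zero_neq_one)
  then have c: "c \<noteq> 0" using f by auto
  have "disc_coeff A 1 = - (4 * c * (A 0 1 * s1^2 + A 1 1 * s1 * s2 + A 2 1 * s2^2))"
    unfolding disc_coeff_def s by (simp add: s algebra_simps)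
  then have "4 * c * (A 0 1 * s1^2 + A 1 1 * s1 * s2 + A 2 1 * s2^2) = 0"
    unfolding disc1 by (metis neg_equal_0_iff_equal)
  then have mid: "A 0 1 * s1^2 + A 1 1 * s1 * s2 + A 2 1 * s2^2 = 0" using c four by simp
  define c' where "c' = binary_quadratic (A 0 2) (A 1 2) (A 2 2) s1 s2"
  \<comment> \<open>There is no term in \<open>u^2\<close> because the form vanishes at
    \<open>s\<close> over \<open>(1, 0)\<close>.\<close>
  have "biquadratic A s1 s2 u v = u * v * (A 0 1 * s1^2 + A 1 1 * s1 * s2 + A 2 1 * s2^2) + c' * (u * 0 - v * 1)^2" for u v
    by (simp add: biquadratic_expand c'_def s algebra_simps power2_eq_square)
  then have "biquadratic A s1 s2 u v = c' * (u * 0 - v * 1)^2" for u v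
    by (simp only: mid mult_zero_right add_0_left)
  with f have "singular_at A s1 s2 1 0" unfolding singular_at_def by blast
  then show False using A s(1) unfolding smooth_def by (metis prod.inject zero_neq_one)
qed

text \<open>To make the quartic even, one root is moved to \<open>(1, 0)\<close> and another to
  \<open>(0, 1)\<close>. The involution of the line that exchanges these two and also the remaining
  two is then turned into a sign change.\<close>

lemma smooth_imp_symmetrizable:
  fixes A :: "nat \<Rightarrow> nat \<Rightarrow> 'a::alg_closed_field"
  assumes two: "(2::'a) \<noteq> 0" and A: "smooth A"
  shows "symmetrizable A"
proof -
  have "\<exists>e f g h. e * h - f * g \<noteq> 0 \<and> disc_coeff (subst_y e f g h A) 0 = 0"
  proof (cases "disc_coeff A 0 = 0")
    case True
    then show ?thesis
      by (intro exI[of _ 1] exI[of _ 0] exI[of _ 0] exI[of _ 1]) (simp add: disc_coeff_subst_y)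
  next
    case False
    have "\<exists>t. poly [:disc_coeff A 4, disc_coeff A 3, disc_coeff A 2, disc_coeff A 1, disc_coeff A 0:] t = 0"
      by (rule alg_closed_imp_poly_has_root) (use False in simp)
    then obtain t where "poly [:disc_coeff A 4, disc_coeff A 3, disc_coeff A 2, disc_coeff A 1, disc_coeff A 0:] t = 0" ..
    then have "disc_coeff (subst_y t 1 1 0 A) 0 = 0"
      by (simp add: disc_coeff_subst_y algebra_simps power2_eq_square power3_eq_cube power4_eq_xxxx)
    then show ?thesis
      by (intro exI[of _ t] exI[of _ 1] exI[of _ 1] exI[of _ 0]) simp
  qed
  then obtain e f g h where d: "e * h - f * g \<noteq> 0" and root: "disc_coeff (subst_y e f g h A) 0 = 0"
    by blast
  define B where "B = subst_y e f g h A"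
  have B: "smooth B" using smooth_subst_y[OF A d] by (simp add: B_def)
  have B0: "disc_coeff B 0 = 0" using root by (simp add: B_def)
  have B1: "disc_coeff B 1 \<noteq> 0" by (rule smooth_disc_simple_root[OF two B B0])
  \<comment> \<open>The quartic at \<open>(t, 1)\<close> is only a cubic in \<open>t\<close>, since
    \<open>(1, 0)\<close> is a root; as this root is simple, the cubic has a root of its
    own.\<close>
  have "\<exists>t. poly [:disc_coeff B 4, disc_coeff B 3, disc_coeff B 2, disc_coeff B 1:] t = 0"
    by (rule alg_closed_imp_poly_has_root) (use B1 in simp)
  then obtain t where t: "poly [:disc_coeff B 4, disc_coeff B 3, disc_coeff B 2, disc_coeff B 1:] t = 0" ..
  define C where "C = subst_y 1 t 0 1 B"
  have C: "smooth C" using smooth_subst_y[OF B, of 1 1 t 0] by (simp add: C_def)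
  have C0: "disc_coeff C 0 = 0" using B0 by (simp add: C_def disc_coeff_subst_y)
  have C4: "disc_coeff C 4 = 0" using t B0
    by (simp add: C_def disc_coeff_subst_y algebra_simps power2_eq_square power3_eq_cube power4_eq_xxxx)
  have C1: "disc_coeff C 1 \<noteq> 0" by (rule smooth_disc_simple_root[OF two C C0])
  have C3: "disc_coeff C 3 \<noteq> 0"
  proof -
    have "smooth (subst_y 0 1 1 0 C)" by (rule smooth_subst_y[OF C]) simp
    then show ?thesis
      using smooth_disc_simple_root[OF two, of "subst_y 0 1 1 0 C"] C4
      by (simp add: disc_coeff_subst_y)
  qed
  \<comment> \<open>The quartic of \<open>C\<close> is \<open>y1 y2\<close> times a quadratic form,
    and \<open>s^2\<close> is the product of the roots of the latter in \<open>z = y1 / y2\<close>.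
    Hence \<open>z -> s^2 / z\<close> exchanges all roots in pairs; in the coordinates
    \<open>y1 = s * (u + v)\<close>, \<open>y2 = u - v\<close> it changes the sign of
    \<open>v\<close>.\<close>
  obtain s where s: "s^2 = disc_coeff C 3 / disc_coeff C 1" by (rule alg_closed_sqrt)
  have s0: "s \<noteq> 0" using s C1 C3 by auto
  have s3: "disc_coeff C 3 = disc_coeff C 1 * s^2" using s C1 by simp
  have det: "s * (- 1) - s * 1 \<noteq> 0"
  proof -
    have "s * (- 1) - s * 1 = - (2 * s)" by simp
    then show ?thesis using two s0 by (metis mult_eq_0_iff neg_equal_0_iff_equal)
  qed
  have "symmetrizable (subst_y s s 1 (-1) C)"
    by (rule symmetrizable_disc_even[OF two _ _ smooth_subst_y[OF C det]])
      (simp_all add: disc_coeff_subst_y C0 C4 s3 algebra_simps power2_eq_square power3_eq_cube power4_eq_xxxx)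
  then have "symmetrizable C" using det by (rule symmetrizable_subst_y)
  then have "symmetrizable B" unfolding C_def by (rule symmetrizable_subst_y) simp
  then show ?thesis using d unfolding B_def by (rule symmetrizable_subst_y)
qed


section \<open>Vanishing to second order at a singular point\<close>

lemma infinite_UNIV_alg_closed: "infinite (UNIV :: 'a::alg_closed_field set)"
proof
  assume fin: "finite (UNIV :: 'a set)"
  \<comment> \<open>Over a finite field this product vanishes everywhere, so \<open>p + 1\<close>
    has positive degree but no root.\<close>
  define p :: "'a poly" where "p = (\<Prod>a\<in>UNIV. [:- a, 1:])"
  have "degree p = card (UNIV :: 'a set)"
    unfolding p_def by (subst degree_prod_eq_sum_degree) auto
  then have deg: "degree p > 0" using fin by (simp add: card_gt_0_iff)
  then have "degree (p + 1) > 0" by (subst degree_add_eq_left) auto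
  then obtain x where "poly (p + 1) x = 0"
    using alg_closed_imp_poly_has_root by blast
  moreover have "poly p x = 0"
    unfolding p_def poly_prod using fin by (intro prod_zero) auto
  ultimately show False by simp
qed

lemma poly_eq_0_of_cofinite_roots:
  fixes p q :: "'a::alg_closed_field poly"
  assumes "\<And>x. poly q x \<noteq> 0 \<Longrightarrow> poly p x = 0" "q \<noteq> 0"
  shows "p = 0"
proof -
  have "poly (p * q) x = 0" for x using assms(1)[of x] by auto
  then have "{x. poly (p * q) x = 0} = UNIV" by auto
  then have "p * q = 0"
    using poly_roots_finite[of "p * q"] infinite_UNIV_alg_closed[where 'a = 'a] by auto
  with assms(2) show ?thesis by simp
qed

lemma poly_eqI_alg_closed:
  fixes p q :: "'a::alg_closed_field poly"
  assumes "\<And>x. poly p x = poly q x"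
  shows "p = q"
  using poly_eq_0_of_cofinite_roots[of 1 "p - q"] assms by simp

lemma quadratic_distinct_roots:
  fixes a b c :: "'a::alg_closed_field"
  assumes two: "(2::'a) \<noteq> 0" and a: "a \<noteq> 0" and disc: "b^2 - 4 * c * a \<noteq> 0"
  obtains s t where "s \<noteq> t" "c + s * (b + s * a) = 0" "c + t * (b + t * a) = 0"
proof -
  obtain r where r: "r^2 = b^2 - 4 * c * a" by (rule alg_closed_sqrt)
  then have r0: "r \<noteq> 0" using disc by auto
  have four: "(4::'a) \<noteq> 0"
    using two by (metis mult_eq_0_iff numeral_Bit0 mult_2)
  have root: "c + (q - b) / (2 * a) * (b + (q - b) / (2 * a) * a) = 0" if q: "q^2 = b^2 - 4 * c * a" for q
  proof -
    define s where "s = (q - b) / (2 * a)"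
    have "q = b + 2 * a * s" using two a by (simp add: s_def)
    then have "4 * a * (c + s * (b + s * a)) = q^2 - (b^2 - 4 * c * a)"
      by (simp add: algebra_simps power2_eq_square)
    also have "\<dots> = 0" using q by simp
    finally show ?thesis using four a unfolding s_def by simp
  qed
  have "(r - b) / (2 * a) \<noteq> (- r - b) / (2 * a)"
  proof
    assume "(r - b) / (2 * a) = (- r - b) / (2 * a)"
    then have "r - b = - r - b" using two a by simp
    then have "2 * r = 0" by (simp add: eq_neg_iff_add_eq_0)
    then show False using two r0 by simp
  qed
  moreover have "(- r)^2 = b^2 - 4 * c * a" using r by simp
  ultimately show thesis by (rule that[OF _ root[OF r] root])
qed

text \<open>The square of a form of bidegree (1, 1) up to a scalar: the shape that an identically
  vanishing discriminant would force at a singular point, and that irreducibility excludes.\<close>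

definition square_form :: "(nat \<Rightarrow> nat \<Rightarrow> 'a::comm_ring_1) \<Rightarrow> bool" where
  "square_form A \<longleftrightarrow> (\<exists>c p q r s. \<forall>x1 x2 y1 y2.
     biquadratic A x1 x2 y1 y2 = c * (p * x1 * y1 + q * x1 * y2 + r * x2 * y1 + s * x2 * y2)^2)"

lemma square_form_transposed:
  assumes "square_form (transposed A)"
  shows "square_form A"
proof -
  obtain c p q r s where "\<And>x1 x2 y1 y2.
     biquadratic A y1 y2 x1 x2 = c * (p * x1 * y1 + q * x1 * y2 + r * x2 * y1 + s * x2 * y2)^2"
    using assms unfolding square_form_def biquadratic_transposed by blast
  then have "biquadratic A x1 x2 y1 y2 = c * (p * x1 * y1 + r * x1 * y2 + q * x2 * y1 + s * x2 * y2)^2"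
    for x1 x2 y1 y2 by (simp add: algebra_simps)
  then show ?thesis unfolding square_form_def by blast
qed

lemma square_form_subst_y:
  fixes A :: "nat \<Rightarrow> nat \<Rightarrow> 'a::field"
  assumes sq: "square_form (subst_y e f g h A)" and det: "e * h - f * g \<noteq> 0"
  shows "square_form A"
proof -
  obtain c p q r s where s: "\<And>x1 x2 y1 y2.
     biquadratic (subst_y e f g h A) x1 x2 y1 y2 = c * (p * x1 * y1 + q * x1 * y2 + r * x2 * y1 + s * x2 * y2)^2"
    using sq unfolding square_form_def by blast
  define d where "d = e * h - f * g"
  have d: "d \<noteq> 0" using det by (simp add: d_def)
  have "biquadratic A x1 x2 y1 y2 = c * ((p * h - q * g) / d * x1 * y1 + (q * e - p * f) / d * x1 * y2
      + (r * h - s * g) / d * x2 * y1 + (s * e - r * f) / d * x2 * y2)^2" for x1 x2 y1 y2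
  proof -
    have "biquadratic A x1 x2 y1 y2 =
        biquadratic (subst_y e f g h A) x1 x2 ((h * y1 - f * y2) / d) ((e * y2 - g * y1) / d)"
      by (simp only: biquadratic_subst_y d_def linear_inverse[OF det])
    also have "\<dots> = c * (p * x1 * ((h * y1 - f * y2) / d) + q * x1 * ((e * y2 - g * y1) / d)
        + r * x2 * ((h * y1 - f * y2) / d) + s * x2 * ((e * y2 - g * y1) / d))^2"
      by (rule s)
    also have "p * x1 * ((h * y1 - f * y2) / d) + q * x1 * ((e * y2 - g * y1) / d)
        + r * x2 * ((h * y1 - f * y2) / d) + s * x2 * ((e * y2 - g * y1) / d) =
        (p * h - q * g) / d * x1 * y1 + (q * e - p * f) / d * x1 * y2
      + (r * h - s * g) / d * x2 * y1 + (s * e - r * f) / d * x2 * y2"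
      using d by (simp add: field_simps)
    finally show ?thesis .
  qed
  then show ?thesis unfolding square_form_def by blast
qed

lemma square_form_subst_x:
  fixes A :: "nat \<Rightarrow> nat \<Rightarrow> 'a::field"
  assumes "square_form (subst_x e f g h A)" "e * h - f * g \<noteq> 0"
  shows "square_form A"
  using square_form_transposed[OF assms(1)[unfolded subst_x_def], THEN square_form_subst_y, OF assms(2)]
  by (rule square_form_transposed)

text \<open>The scalars \<open>c\<close>, \<open>l\<close>, \<open>k\<close> of the square are read
  off from \<open>A 2 0\<close>, \<open>A 1 1\<close>, \<open>A 2 1\<close>. The coefficients 2, 3,
  4 of the discriminant then determine \<open>A 0 2\<close>, \<open>A 1 2\<close>,
  \<open>A 2 2\<close> in turn.\<close>

lemma square_form_if_disc_zero:
  fixes A :: "nat \<Rightarrow> nat \<Rightarrow> 'a::alg_closed_field"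
  assumes two: "(2::'a) \<noteq> 0" and z: "A 0 0 = 0" "A 1 0 = 0" "A 0 1 = 0"
    and nz: "A 2 0 \<noteq> 0" "A 0 2 \<noteq> 0"
    and disc: "\<And>k. disc_coeff A k = 0"
  shows "square_form A"
proof -
  have four: "(4::'a) \<noteq> 0"
    using two by (metis mult_eq_0_iff numeral_Bit0 mult_2)
  define c where "c = A 2 0"
  define l where "l = A 1 1 / (2 * c)"
  define k where "k = A 2 1 / (2 * c)"
  have c: "c \<noteq> 0" using nz by (simp add: c_def)
  have A11: "A 1 1 = 2 * c * l" and A21: "A 2 1 = 2 * c * k"
    using two c by (simp_all add: l_def k_def)
  have "4 * c * (c * l^2 - A 0 2) = disc_coeff A 2"
    by (simp add: disc_coeff_def z A11 c_def[symmetric] algebra_simps power2_eq_square)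
  then have A02: "A 0 2 = c * l^2" using disc four c by simp
  then have l: "l \<noteq> 0" using nz by auto
  have "4 * c * l * (A 1 2 - 2 * c * l * k) = disc_coeff A 3"
    by (simp add: disc_coeff_def z A11 A21 A02 algebra_simps power2_eq_square)
  then have A12: "A 1 2 = 2 * c * l * k" using disc four c l by simp
  have "4 * c * l^2 * (c * k^2 - A 2 2) = disc_coeff A 4"
    by (simp add: disc_coeff_def z A12 A02 algebra_simps power2_eq_square)
  then have A22: "A 2 2 = c * k^2" using disc four c l by simp
  have "biquadratic A x1 x2 y1 y2 = c * (0 * x1 * y1 + l * x1 * y2 + 1 * x2 * y1 + k * x2 * y2)^2"
    for x1 x2 y1 y2
    by (simp add: biquadratic_expand z A11 A21 A02 A12 A22 c_def[symmetric] algebra_simps power2_eq_square)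
  then show ?thesis unfolding square_form_def by blast
qed

text \<open>Pseudo-division by the equation of the curve, whose leading coefficient in \<open>s\<close> does not
  vanish at the singular point; the remainder is linear in \<open>s\<close> and has two zeros for almost
  every \<open>t\<close>.\<close>

lemma vanishing_second_order_normalized:
  fixes A :: "nat \<Rightarrow> nat \<Rightarrow> 'a::alg_closed_field" and g :: "'a poly poly"
  assumes two: "(2::'a) \<noteq> 0" and z: "A 0 0 = 0" "A 1 0 = 0" "A 0 1 = 0"
    and nz: "A 2 0 \<noteq> 0" "A 0 2 \<noteq> 0" and nsq: "\<not> square_form A"
    and van: "\<And>s t. biquadratic A 1 s 1 t = 0 \<Longrightarrow> poly (poly g [:s:]) t = 0"
  shows "coeff (coeff g 0) 1 = 0" "coeff (coeff g 1) 0 = 0"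
proof -
  \<comment> \<open>In the chart \<open>x = (1, s)\<close>, \<open>y = (1, t)\<close> the form is a
    polynomial in the outer variable \<open>s\<close> whose coefficients \<open>P i\<close> are
    polynomials in the inner variable \<open>t\<close>.\<close>
  define P where "P i = [:A i 0, A i 1, A i 2:]" for i
  define f where "f = [:P 0, P 1, P 2:]"
  have P2: "P 2 \<noteq> 0" using nz by (simp add: P_def)
  have degf: "degree f = 2" and lcf: "coeff f (degree f) = P 2" and f0: "f \<noteq> 0"
    using P2 by (simp_all add: f_def numeral_2_eq_2)
  have evf: "poly (poly f [:s:]) t = biquadratic A 1 s 1 t" for s t
    by (simp add: f_def P_def biquadratic_expand algebra_simps power2_eq_square)
  define D where "D = P 1 ^ 2 - 4 * P 0 * P 2"
  have "D = [:disc_coeff A 0, disc_coeff A 1, disc_coeff A 2, disc_coeff A 3, disc_coeff A 4:]"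
    by (rule poly_eqI_alg_closed)
      (simp add: D_def P_def disc_coeff_def algebra_simps power2_eq_square)
  \<comment> \<open>\<open>disc_coeff\<close> keeps its last value beyond index 4, so
    \<open>D = 0\<close> would give the vanishing required for every \<open>k\<close>.\<close>
  moreover have "disc_coeff A k = disc_coeff A 4" if "k \<ge> 4" for k
    using that by (simp add: disc_coeff_def)
  moreover have "k = 0 \<or> k = 1 \<or> k = 2 \<or> k = 3 \<or> k \<ge> 4" for k :: nat by arith
  ultimately have D: "D \<noteq> 0"
    using square_form_if_disc_zero[OF two z nz] nsq by (metis pCons_eq_0_iff)
  obtain q r where qr: "pseudo_divmod g f = (q, r)" by force
  define n where "n = Suc (degree g) - degree f"
  have div: "smult (P 2 ^ n) g = f * q + r" and degr: "r = 0 \<or> degree r < 2"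
    using pseudo_divmod[OF f0 qr] by (simp_all add: lcf[unfolded degf] n_def degf)
  have r: "r = [:coeff r 0, coeff r 1:]"
  proof (rule poly_eqI)
    fix k
    show "coeff r k = coeff [:coeff r 0, coeff r 1:] k"
      using degr coeff_eq_0[of r k]
      by (cases k; cases "k - 1") (auto simp: coeff_pCons One_nat_def split: nat.splits)
  qed
  have rz: "poly (coeff r 0) t = 0 \<and> poly (coeff r 1) t = 0" if t: "poly (P 2 * D) t \<noteq> 0" for t
  proof -
    have "poly (P 2) t \<noteq> 0" "poly (P 1) t ^ 2 - 4 * poly (P 0) t * poly (P 2) t \<noteq> 0"
      using t by (auto simp: D_def)
    then obtain s s' where s: "s \<noteq> s'"
      "poly (P 0) t + s * (poly (P 1) t + s * poly (P 2) t) = 0"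
      "poly (P 0) t + s' * (poly (P 1) t + s' * poly (P 2) t) = 0"
      using quadratic_distinct_roots[OF two] by metis
    have rs: "poly (coeff r 0) t + s * poly (coeff r 1) t = 0"
      if "poly (P 0) t + s * (poly (P 1) t + s * poly (P 2) t) = 0" for s
    proof -
      have f: "poly (poly f [:s:]) t = 0" using that by (simp add: f_def)
      then have "poly (poly g [:s:]) t = 0" using van evf by simp
      then have "poly (poly r [:s:]) t = 0"
        using arg_cong[OF div, of "\<lambda>p. poly (poly p [:s:]) t"] f by simp
      then show ?thesis by (subst (asm) r) simp
    qed
    have "(s - s') * poly (coeff r 1) t = 0"
      using rs[OF s(2)] rs[OF s(3)] by (simp add: algebra_simps add_eq_0_iff)
    then show ?thesis using s(1) rs[OF s(2)] by simp
  qed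
  have "coeff r 0 = 0" "coeff r 1 = 0"
    by (rule poly_eq_0_of_cofinite_roots[of "P 2 * D"]; use rz P2 D in auto)+
  then have "r = 0" by (subst r) simp
  then have div: "smult (P 2 ^ n) g = f * q" using div by simp
  \<comment> \<open>\<open>P 0\<close> is divisible by \<open>t^2\<close> and \<open>P 1\<close> by
    \<open>t\<close>, so \<open>K * g = f * q\<close> has no linear terms at the origin. Since
    \<open>K\<close> is nonzero at \<open>t = 0\<close>, neither has \<open>g\<close>.\<close>
  define K where "K = P 2 ^ n"
  have K: "coeff K 0 \<noteq> 0" using nz by (simp add: K_def P_def coeff_0_power)
  have e0: "K * coeff g 0 = P 0 * coeff q 0" and e1: "K * coeff g 1 = P 0 * coeff q 1 + P 1 * coeff q 0"
    using arg_cong[OF div, of "\<lambda>p. coeff p 0"] arg_cong[OF div, of "\<lambda>p. coeff p 1"]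
    by (simp_all add: f_def K_def coeff_mult One_nat_def)
  have g00: "coeff (coeff g 0) 0 = 0"
    using arg_cong[OF e0, of "\<lambda>p. coeff p 0"] K z by (simp add: coeff_mult P_def)
  have "coeff K 0 * coeff (coeff g 0) 1 = 0"
    using arg_cong[OF e0, of "\<lambda>p. coeff p 1"] g00 z by (simp add: coeff_mult P_def One_nat_def)
  then show "coeff (coeff g 0) 1 = 0" using K by simp
  have "coeff K 0 * coeff (coeff g 1) 0 = 0"
    using arg_cong[OF e1, of "\<lambda>p. coeff p 0"] z by (simp add: coeff_mult P_def)
  then show "coeff (coeff g 1) 0 = 0" using K by simp
qed

text \<open>With the bases \<open>(x, u)\<close> and \<open>(y, w)\<close> the singular point
  becomes \<open>(1, 0), (1, 0)\<close> and \<open>s\<close>, \<open>t\<close> become affine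
  coordinates. The double roots there annihilate \<open>B 0 0\<close>, \<open>B 1 0\<close>,
  \<open>B 0 1\<close>; \<open>B 2 0\<close> and \<open>B 0 2\<close> survive because the form is
  nonzero on both fibres through the point.\<close>

lemma vanishing_second_order:
  fixes A :: "nat \<Rightarrow> nat \<Rightarrow> 'a::alg_closed_field" and g :: "'a poly poly"
  assumes two: "(2::'a) \<noteq> 0" and nsq: "\<not> square_form A"
    and sing: "singular_at A x1 x2 y1 y2"
    and nlx: "\<exists>u v. biquadratic A x1 x2 u v \<noteq> 0" and nly: "\<exists>u v. biquadratic A u v y1 y2 \<noteq> 0"
    and det: "x1 * u2 - u1 * x2 \<noteq> 0" "y1 * w2 - w1 * y2 \<noteq> 0"
    and van: "\<And>s t. biquadratic A (x1 + u1 * s) (x2 + u2 * s) (y1 + w1 * t) (y2 + w2 * t) = 0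
      \<Longrightarrow> poly (poly g [:s:]) t = 0"
  shows "coeff (coeff g 0) 1 = 0" "coeff (coeff g 1) 0 = 0"
proof -
  obtain c c' where c: "\<And>u v. biquadratic A u v y1 y2 = c * (u * x2 - v * x1)^2"
    and c': "\<And>u v. biquadratic A x1 x2 u v = c' * (u * y2 - v * y1)^2"
    using sing unfolding singular_at_def by blast
  have c0: "c \<noteq> 0" and c0': "c' \<noteq> 0" using c c' nlx nly by auto
  define B where "B = subst_x x1 u1 x2 u2 (subst_y y1 w1 y2 w2 A)"
  have evB: "biquadratic B X1 X2 Y1 Y2 =
      biquadratic A (x1 * X1 + u1 * X2) (x2 * X1 + u2 * X2) (y1 * Y1 + w1 * Y2) (y2 * Y1 + w2 * Y2)"
    for X1 X2 Y1 Y2 by (simp add: B_def biquadratic_subst_x biquadratic_subst_y)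
  have "binary_quadratic (B 0 0) (B 1 0) (B 2 0) u v =
      binary_quadratic 0 0 (c * (x1 * u2 - u1 * x2)^2) u v" for u v
  proof -
    have "binary_quadratic (B 0 0) (B 1 0) (B 2 0) u v = biquadratic B u v 1 0"
      by (simp add: biquadratic_expand)
    also have "\<dots> = c * ((x1 * u + u1 * v) * x2 - (x2 * u + u2 * v) * x1)^2"
      by (simp add: evB c)
    also have "\<dots> = binary_quadratic 0 0 (c * (x1 * u2 - u1 * x2)^2) u v"
      by (simp add: binary_quadratic_def algebra_simps power2_eq_square)
    finally show ?thesis .
  qed
  note colx = binary_quadratic_eqD[OF this]
  have "binary_quadratic (B 0 0) (B 0 1) (B 0 2) u v =
      binary_quadratic 0 0 (c' * (y1 * w2 - w1 * y2)^2) u v" for u v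
  proof -
    have "binary_quadratic (B 0 0) (B 0 1) (B 0 2) u v = biquadratic B 1 0 u v"
      by (simp add: biquadratic_expand)
    also have "\<dots> = c' * ((y1 * u + w1 * v) * y2 - (y2 * u + w2 * v) * y1)^2"
      by (simp add: evB c')
    also have "\<dots> = binary_quadratic 0 0 (c' * (y1 * w2 - w1 * y2)^2) u v"
      by (simp add: binary_quadratic_def algebra_simps power2_eq_square)
    finally show ?thesis .
  qed
  note coly = binary_quadratic_eqD[OF this]
  have "\<not> square_form B"
    using nsq det square_form_subst_x square_form_subst_y unfolding B_def by blast
  then show "coeff (coeff g 0) 1 = 0" "coeff (coeff g 1) 0 = 0"
    using vanishing_second_order_normalized[OF two, of B g] colx coly c0 c0' det van
    by (simp_all add: evB)
qed


section \<open>Bihomogeneous polynomials of bidegree (2, 2)\<close>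

lemma UNIV_two_plus_two: "(UNIV :: (2 + 2) set) = {Inl 1, Inl 2, Inr 1, Inr 2}"
  by (auto simp: UNIV_sum UNIV_2)

lemma prod_UNIV_two_plus_two:
  fixes f :: "2 + 2 \<Rightarrow> 'a::comm_monoid_mult"
  shows "(\<Prod>v\<in>UNIV. f v) = f (Inl 1) * f (Inl 2) * f (Inr 1) * f (Inr 2)"
  unfolding UNIV_two_plus_two by (simp add: mult.assoc)

section \<open>Evaluation and restriction of multivariate polynomials\<close>

lemma mpoly_eval_eq_sum:
  assumes "finite S" "Poly_Mapping.keys p \<subseteq> S"
  shows "mpoly_eval p x = (\<Sum>m\<in>S. Poly_Mapping.lookup p m * (\<Prod>v\<in>UNIV. x v ^ Poly_Mapping.lookup m v))"
  unfolding mpoly_eval_def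
  using assms by (intro sum.mono_neutral_left) (auto simp: in_keys_iff)

lemma mpoly_eval_add: "mpoly_eval (p + q) x = mpoly_eval p x + mpoly_eval q x"
proof -
  let ?S = "Poly_Mapping.keys p \<union> Poly_Mapping.keys q"
  have "Poly_Mapping.keys (p + q) \<subseteq> ?S" by (rule Poly_Mapping.keys_add)
  then show ?thesis
    by (subst (1 2 3) mpoly_eval_eq_sum[of ?S])
      (auto simp: lookup_add algebra_simps sum.distrib)
qed

lemma mpoly_eval_zero [simp]: "mpoly_eval 0 x = 0"
  by (simp add: mpoly_eval_def)

lemma mpoly_eval_sum: "mpoly_eval (\<Sum>i\<in>S. p i) x = (\<Sum>i\<in>S. mpoly_eval (p i) x)"
  by (induction S rule: infinite_finite_induct) (simp_all add: mpoly_eval_add)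

lemma mpoly_eval_single:
  "mpoly_eval (Poly_Mapping.single m c) x = c * (\<Prod>v\<in>UNIV. x v ^ Poly_Mapping.lookup m v)"
  by (cases "c = 0") (simp_all add: mpoly_eval_def)

lemma mpoly_eval_deriv:
  fixes p :: "('v::finite, 'a::comm_ring_1) mpoly"
  shows "mpoly_eval (mpoly_deriv v p) z = (\<Sum>m\<in>Poly_Mapping.keys p. Poly_Mapping.lookup p m *
    (of_nat (Poly_Mapping.lookup m v) * z v ^ (Poly_Mapping.lookup m v - 1)) *
    (\<Prod>w\<in>UNIV - {v}. z w ^ Poly_Mapping.lookup m w))"
  unfolding mpoly_deriv_def mpoly_eval_sum mpoly_eval_single
proof (rule sum.cong)
  fix m
  have "(\<Prod>w\<in>UNIV. z w ^ Poly_Mapping.lookup (m - Poly_Mapping.single v 1) w) =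
      z v ^ (Poly_Mapping.lookup m v - 1) * (\<Prod>w\<in>UNIV - {v}. z w ^ Poly_Mapping.lookup m w)"
    by (subst prod.remove[of _ v]) (auto simp: lookup_minus lookup_single intro!: arg_cong2[of _ _ _ _ "(*)"] prod.cong)
  then show "of_nat (Poly_Mapping.lookup m v) * Poly_Mapping.lookup p m *
      (\<Prod>w\<in>UNIV. z w ^ Poly_Mapping.lookup (m - Poly_Mapping.single v 1) w) =
    Poly_Mapping.lookup p m *
    (of_nat (Poly_Mapping.lookup m v) * z v ^ (Poly_Mapping.lookup m v - 1)) *
    (\<Prod>w\<in>UNIV - {v}. z w ^ Poly_Mapping.lookup m w)"
    by (simp add: algebra_simps)
qed simp

text \<open>Makes the formal partial derivative the linear coefficient along a coordinate line,
  where it can be found by comparing polynomials in one variable.\<close>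

lemma mpoly_eval_axis_line:
  fixes p :: "('v::finite, 'a::idom) mpoly"
  obtains P where "\<And>s. poly P s = mpoly_eval p (z(v := z v + s))"
    and "coeff P 1 = mpoly_eval (mpoly_deriv v p) z"
proof -
  define P where "P = (\<Sum>m\<in>Poly_Mapping.keys p.
    smult (Poly_Mapping.lookup p m * (\<Prod>w\<in>UNIV - {v}. z w ^ Poly_Mapping.lookup m w))
      ([:z v, 1:] ^ Poly_Mapping.lookup m v))"
  have "poly P s = mpoly_eval p (z(v := z v + s))" for s
  proof -
    have "(\<Prod>w\<in>UNIV. (z(v := z v + s)) w ^ Poly_Mapping.lookup m w) =
        (z v + s) ^ Poly_Mapping.lookup m v * (\<Prod>w\<in>UNIV - {v}. z w ^ Poly_Mapping.lookup m w)" for m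
      by (subst prod.remove[of _ v]) (auto intro!: arg_cong2[of _ _ _ _ "(*)"] prod.cong)
    then show ?thesis
      unfolding P_def mpoly_eval_def by (simp add: poly_sum algebra_simps)
  qed
  moreover have "coeff P 1 = mpoly_eval (mpoly_deriv v p) z"
  proof -
    have "coeff ([:a, 1:] ^ n) 1 = of_nat n * a ^ (n - 1)" for a :: 'a and n
    proof -
      have "coeff ([:a, 1:] ^ n) 1 = poly (pderiv ([:a, 1:] ^ n)) 0"
        by (simp add: poly_0_coeff_0 coeff_pderiv One_nat_def)
      also have "\<dots> = of_nat n * a ^ (n - 1)"
        by (cases n) (simp_all add: pderiv_power_Suc pderiv_pCons del: power_Suc)
      finally show ?thesis .
    qed
    then show ?thesis
      unfolding P_def mpoly_eval_deriv by (simp add: coeff_sum algebra_simps)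
  qed
  ultimately show thesis by (rule that)
qed

lemma mpoly_eval_plane:
  fixes p :: "('v::finite, 'a::comm_ring_1) mpoly"
  obtains g :: "'a poly poly" where "\<And>s t. poly (poly g [:s:]) t = mpoly_eval p (\<lambda>v. a v + s * b v + t * c v)"
proof -
  define g where "g = (\<Sum>m\<in>Poly_Mapping.keys p. [:[:Poly_Mapping.lookup p m:]:] *
    (\<Prod>v\<in>UNIV. [:[:a v, c v:], [:b v:]:] ^ Poly_Mapping.lookup m v))"
  have "poly (poly g [:s:]) t = mpoly_eval p (\<lambda>v. a v + s * b v + t * c v)" for s t
    unfolding g_def mpoly_eval_def by (simp add: poly_sum poly_prod algebra_simps)
  then show thesis by (rule that)
qed

text \<open>Setting the inner variable to \<open>0\<close> takes each coefficient in the outer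
  variable to its constant term.\<close>

lemma poly_restrict_fst:
  obtains h where "\<And>s. poly h s = poly (poly g [:s:]) 0" "coeff h 1 = coeff (coeff g 1) 0"
proof -
  have "poly (map_poly (\<lambda>c. coeff c 0) g) s = poly (poly g [:s:]) 0" for s
    by (induction g) (simp_all add: map_poly_pCons poly_0_coeff_0[symmetric])
  moreover have "coeff (map_poly (\<lambda>c. coeff c 0) g) 1 = coeff (coeff g 1) 0"
    by (simp add: coeff_map_poly)
  ultimately show thesis by (rule that)
qed

text \<open>Exponents are natural numbers, so a sum of two exponent vectors is zero only if both
  are. This serves to recognize nonunits.\<close>

lemma lookup_times_zero:
  fixes p q :: "('v \<Rightarrow>\<^sub>0 nat) \<Rightarrow>\<^sub>0 'a::comm_ring_1"
  shows "Poly_Mapping.lookup (p * q) 0 = Poly_Mapping.lookup p 0 * Poly_Mapping.lookup q 0"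
proof -
  have sum0: "k + l = 0 \<longleftrightarrow> k = 0 \<and> l = 0" for k l :: "'v \<Rightarrow>\<^sub>0 nat"
    by (auto simp: poly_mapping_eq_iff fun_eq_iff lookup_add)
  have "(\<Sum>l. Poly_Mapping.lookup q l when (0 :: 'v \<Rightarrow>\<^sub>0 nat) = k + l) = (Poly_Mapping.lookup q 0 when k = 0)" for k
    by (cases "k = 0") (simp_all add: sum0 eq_commute[of 0])
  then show ?thesis by (simp add: lookup_mult mult_when)
qed

lemma not_unit_of_lookup_zero:
  fixes p :: "('v \<Rightarrow>\<^sub>0 nat) \<Rightarrow>\<^sub>0 'a::comm_ring_1"
  assumes "Poly_Mapping.lookup p 0 = 0"
  shows "\<not> p dvd 1"
proof
  assume "p dvd 1"
  then obtain q where "1 = p * q" by (rule dvdE)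
  then have "Poly_Mapping.lookup (1 :: ('v \<Rightarrow>\<^sub>0 nat) \<Rightarrow>\<^sub>0 'a) 0 = Poly_Mapping.lookup p 0 * Poly_Mapping.lookup q 0"
    by (simp add: lookup_times_zero[symmetric])
  with assms show False by simp
qed

text \<open>The indices are the exponents of the second variables, as in \<open>biquadratic\<close>;
  because of the truncated subtraction, only \<open>i, j \<le> 2\<close> give bidegree (2,
  2).\<close>

definition bi_monomial :: "nat \<Rightarrow> nat \<Rightarrow> (2 + 2) \<Rightarrow>\<^sub>0 nat" where
  "bi_monomial i j = Poly_Mapping.single (Inl 1) (2 - i) + Poly_Mapping.single (Inl 2) i
     + Poly_Mapping.single (Inr 1) (2 - j) + Poly_Mapping.single (Inr 2) j"

definition bi_coeff :: "'a::zero bipoly \<Rightarrow> nat \<Rightarrow> nat \<Rightarrow> 'a" where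
  "bi_coeff F i j = Poly_Mapping.lookup F (bi_monomial i j)"

lemma lookup_bi_monomial:
  "Poly_Mapping.lookup (bi_monomial i j) (Inl 1) = 2 - i" "Poly_Mapping.lookup (bi_monomial i j) (Inl 2) = i"
  "Poly_Mapping.lookup (bi_monomial i j) (Inr 1) = 2 - j" "Poly_Mapping.lookup (bi_monomial i j) (Inr 2) = j"
  by (simp_all add: bi_monomial_def lookup_add lookup_single)

lemma inj_bi_monomial: "bi_monomial i j = bi_monomial k l \<longleftrightarrow> i = k \<and> j = l"
  by (metis lookup_bi_monomial(2,4))

lemma keys_bihomogeneous_2_2:
  assumes "bihomogeneous 2 2 F"
  shows "Poly_Mapping.keys F \<subseteq> (\<lambda>(i, j). bi_monomial i j) ` ({..2} \<times> {..2})"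
proof
  fix m assume "m \<in> Poly_Mapping.keys F"
  then have m: "Poly_Mapping.lookup m (Inl 1) + Poly_Mapping.lookup m (Inl 2) = 2"
    "Poly_Mapping.lookup m (Inr 1) + Poly_Mapping.lookup m (Inr 2) = 2"
    using assms by (auto simp: bihomogeneous_def sum_2)
  have "m = bi_monomial (Poly_Mapping.lookup m (Inl 2)) (Poly_Mapping.lookup m (Inr 2))"
  proof (rule poly_mapping_eqI)
    fix v :: "2 + 2"
    have "v \<in> {Inl 1, Inl 2, Inr 1, Inr 2}" using UNIV_two_plus_two by blast
    then show "Poly_Mapping.lookup m v = Poly_Mapping.lookup
        (bi_monomial (Poly_Mapping.lookup m (Inl 2)) (Poly_Mapping.lookup m (Inr 2))) v"
      using m by (elim insertE) (simp_all only: lookup_bi_monomial, auto)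
  qed
  then show "m \<in> (\<lambda>(i, j). bi_monomial i j) ` ({..2} \<times> {..2})"
    using m by (intro image_eqI[of _ _ "(Poly_Mapping.lookup m (Inl 2), Poly_Mapping.lookup m (Inr 2))"]) auto
qed

lemma bihomogeneous_eq_sum:
  fixes F :: "'a::comm_ring_1 bipoly"
  assumes "bihomogeneous 2 2 F"
  shows "F = (\<Sum>i\<le>2. \<Sum>j\<le>2. Poly_Mapping.single (bi_monomial i j) (bi_coeff F i j))"
proof -
  let ?h = "\<lambda>(i, j). bi_monomial i j"
  have inj: "inj_on ?h ({..2} \<times> {..2})" by (auto simp: inj_on_def inj_bi_monomial)
  have "F = (\<Sum>m\<in>?h ` ({..2} \<times> {..2}). Poly_Mapping.single m (Poly_Mapping.lookup F m))"
  proof (rule poly_mapping_eqI)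
    fix k
    show "Poly_Mapping.lookup F k = Poly_Mapping.lookup
        (\<Sum>m\<in>?h ` ({..2} \<times> {..2}). Poly_Mapping.single m (Poly_Mapping.lookup F m)) k"
      using keys_bihomogeneous_2_2[OF assms]
      by (auto simp: lookup_sum lookup_single when_def sum.delta in_keys_iff)
  qed
  also have "\<dots> = (\<Sum>(i, j)\<in>{..2} \<times> {..2}. Poly_Mapping.single (bi_monomial i j) (bi_coeff F i j))"
    by (subst sum.reindex[OF inj]) (simp add: bi_coeff_def case_prod_unfold)
  finally show ?thesis by (simp add: sum.cartesian_product)
qed

lemma bipoly_eval_bihomogeneous:
  fixes F :: "'a::comm_ring_1 bipoly"
  assumes "bihomogeneous 2 2 F"
  shows "bipoly_eval F x y = biquadratic (bi_coeff F) (x $ 1) (x $ 2) (y $ 1) (y $ 2)"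
proof -
  have "bipoly_eval F x y = (\<Sum>i\<le>2. \<Sum>j\<le>2. bi_coeff F i j *
      ((x $ 1)^(2 - i) * (x $ 2)^i * (y $ 1)^(2 - j) * (y $ 2)^j))"
    unfolding bipoly_eval_def
    by (subst bihomogeneous_eq_sum[OF assms])
      (simp add: mpoly_eval_sum mpoly_eval_single prod_UNIV_two_plus_two lookup_bi_monomial)
  also have "\<dots> = biquadratic (bi_coeff F) (x $ 1) (x $ 2) (y $ 1) (y $ 2)"
    by (simp add: numeral_2_eq_2 biquadratic_expand One_nat_def algebra_simps)
  finally show ?thesis .
qed

section \<open>Factorizations in the polynomial ring\<close>

definition mconst :: "'a \<Rightarrow> ('v, 'a::comm_ring_1) mpoly" where
  "mconst c = Poly_Mapping.single 0 c"

definition mvar :: "'v \<Rightarrow> ('v, 'a::comm_ring_1) mpoly" where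
  "mvar v = Poly_Mapping.single (Poly_Mapping.single v 1) 1"

lemma mvar_power: "mvar v ^ n = Poly_Mapping.single (Poly_Mapping.single v n) 1"
  by (induction n) (simp_all add: mvar_def mult_single single_add[symmetric] One_nat_def)

lemma mconst_arith:
  "mconst (a + b) = mconst a + mconst b" "mconst (a - b) = mconst a - mconst b"
  "mconst (- a) = - mconst a" "mconst (a * b) = mconst a * mconst b"
  "mconst 0 = 0" "mconst 1 = 1" "mconst (a ^ 2) = mconst a ^ 2" "mconst 2 = 2"
  by (simp_all add: mconst_def single_add single_diff single_uminus mult_single power2_eq_square)

lemma lookup_mvar_zero [simp]: "Poly_Mapping.lookup (mvar v) 0 = 0"
  by (auto simp: mvar_def lookup_single when_def poly_mapping_eq_iff fun_eq_iff lookup_single)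

text \<open>An identity of polynomials rather than of values, so that factorizations found on
  coefficients become factorizations of \<open>F\<close>.\<close>

lemma bihomogeneous_eq_biquadratic:
  fixes F :: "'a::comm_ring_1 bipoly"
  assumes "bihomogeneous 2 2 F"
  shows "F = biquadratic (\<lambda>i j. mconst (bi_coeff F i j))
    (mvar (Inl 1)) (mvar (Inl 2)) (mvar (Inr 1)) (mvar (Inr 2))"
proof -
  have "Poly_Mapping.single (bi_monomial i j) c =
    mconst c * (mvar (Inl 1) ^ (2 - i) * mvar (Inl 2) ^ i * mvar (Inr 1) ^ (2 - j) * mvar (Inr 2) ^ j)"
    for i j and c :: 'a
    by (simp add: mvar_power mconst_def mult_single bi_monomial_def)
  then have "F = (\<Sum>i\<le>2. \<Sum>j\<le>2. mconst (bi_coeff F i j) *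
    (mvar (Inl 1) ^ (2 - i) * mvar (Inl 2) ^ i * mvar (Inr 1) ^ (2 - j) * mvar (Inr 2) ^ j))"
    using bihomogeneous_eq_sum[OF assms] by simp
  also have "\<dots> = biquadratic (\<lambda>i j. mconst (bi_coeff F i j))
    (mvar (Inl 1)) (mvar (Inl 2)) (mvar (Inr 1)) (mvar (Inr 2))"
    by (simp add: numeral_2_eq_2 biquadratic_expand One_nat_def algebra_simps)
  finally show ?thesis .
qed

text \<open>A root \<open>(r, s)\<close> splits off the linear form \<open>s * u - r * v\<close>,
  with cofactor \<open>p * u + q * v\<close>. Stated on coefficients, the factorization can be
  transferred to polynomial variables.\<close>

lemma binary_quadratic_root_factor:
  fixes a b c :: "'a::field"
  assumes "(r, s) \<noteq> (0, 0)" "binary_quadratic a b c r s = 0"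
  obtains p q where "a = s * p" "b = s * q - r * p" "c = - (r * q)"
proof (cases "s = 0")
  case True
  then have r: "r \<noteq> 0" and a: "a = 0" using assms by (auto simp: binary_quadratic_def)
  then show thesis using that[of "- b / r" "- c / r"] True by simp
next
  case False
  define p where "p = a / s"
  define q where "q = (b + r * p) / s"
  have a: "a = s * p" and b: "b = s * q - r * p" using False by (simp_all add: p_def q_def)
  have "s^2 * (c + r * q) = 0"
    using assms(2) unfolding a b binary_quadratic_def by (simp add: algebra_simps power2_eq_square)
  then have "c = - (r * q)" using False by (simp add: add_eq_0_iff2)
  with a b show thesis by (rule that)
qed

text \<open>Otherwise \<open>y\<close> is a common root of the three coefficient forms, and
  \<open>y2 * Y1 - y1 * Y2\<close> is a proper factor. The variables stay abstract so that the two
  lines can exchange roles.\<close>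

lemma irreducible_biquadratic_nonvanishing:
  fixes A :: "nat \<Rightarrow> nat \<Rightarrow> 'a::field" and X1 X2 Y1 Y2 :: "('v, 'a) mpoly"
  assumes irr: "irreducible (biquadratic (\<lambda>i j. mconst (A i j)) X1 X2 Y1 Y2)"
    and X: "Poly_Mapping.lookup X1 0 = 0" "Poly_Mapping.lookup X2 0 = 0"
      "Poly_Mapping.lookup Y1 0 = 0" "Poly_Mapping.lookup Y2 0 = 0"
    and y: "(y1, y2) \<noteq> (0, 0)"
  shows "\<exists>u v. biquadratic A u v y1 y2 \<noteq> 0"
proof (rule ccontr)
  assume "\<not> ?thesis"
  then have "binary_quadratic (binary_quadratic (A 0 0) (A 0 1) (A 0 2) y1 y2)
       (binary_quadratic (A 1 0) (A 1 1) (A 1 2) y1 y2)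
       (binary_quadratic (A 2 0) (A 2 1) (A 2 2) y1 y2) u v = binary_quadratic 0 0 0 u v" for u v
    by (simp add: biquadratic_def binary_quadratic_def[of 0])
  note z = binary_quadratic_eqD[OF this]
  obtain p0 q0 where 0: "A 0 0 = y2 * p0" "A 0 1 = y2 * q0 - y1 * p0" "A 0 2 = - (y1 * q0)"
    using binary_quadratic_root_factor[OF y z(1)] .
  obtain p1 q1 where 1: "A 1 0 = y2 * p1" "A 1 1 = y2 * q1 - y1 * p1" "A 1 2 = - (y1 * q1)"
    using binary_quadratic_root_factor[OF y z(2)] .
  obtain p2 q2 where 2: "A 2 0 = y2 * p2" "A 2 1 = y2 * q2 - y1 * p2" "A 2 2 = - (y1 * q2)"
    using binary_quadratic_root_factor[OF y z(3)] .
  define L where "L = mconst y2 * Y1 - mconst y1 * Y2"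
  define H where "H = binary_quadratic (mconst p0 * Y1 + mconst q0 * Y2)
    (mconst p1 * Y1 + mconst q1 * Y2) (mconst p2 * Y1 + mconst q2 * Y2) X1 X2"
  have "biquadratic (\<lambda>i j. mconst (A i j)) X1 X2 Y1 Y2 = L * H"
    unfolding biquadratic_expand L_def H_def 0 1 2 mconst_arith
    by (simp add: algebra_simps power2_eq_square)
  moreover have "\<not> L dvd 1" "\<not> H dvd 1"
    by (rule not_unit_of_lookup_zero;
      simp add: L_def H_def binary_quadratic_def X lookup_times_zero lookup_minus lookup_add power2_eq_square)+
  ultimately show False using irr by (auto dest: irreducibleD)
qed

lemma biquadratic_eqD:
  assumes eq: "\<And>x1 x2 y1 y2. biquadratic A x1 x2 y1 y2 = biquadratic B x1 x2 y1 y2"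
    and "i \<le> 2" "j \<le> 2"
  shows "A i j = B i j"
proof -
  have le2: "k = 0 \<or> k = 1 \<or> k = 2" if "k \<le> 2" for k :: nat
    using that by arith
  have "binary_quadratic (A i 0) (A i 1) (A i 2) u v = binary_quadratic (B i 0) (B i 1) (B i 2) u v" for u v
    using binary_quadratic_eqD[OF eq[unfolded biquadratic_def], of u v] le2[OF assms(2)] by blast
  note c = binary_quadratic_eqD[OF this]
  show ?thesis using c le2[OF assms(3)] by blast
qed

lemma irreducible_not_square_form:
  fixes F :: "'a::field bipoly"
  assumes irr: "irreducible F" and F: "bihomogeneous 2 2 F"
  shows "\<not> square_form (bi_coeff F)"
proof
  let ?A = "bi_coeff F"
  assume "square_form ?A"
  then obtain c p q r s where sq: "\<And>x1 x2 y1 y2. biquadratic ?A x1 x2 y1 y2 =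
      c * (p * x1 * y1 + q * x1 * y2 + r * x2 * y1 + s * x2 * y2)^2"
    unfolding square_form_def by blast
  \<comment> \<open>The coefficients of the expanded square; equality of values must become equality
    of coefficients before it can be lifted to the polynomial ring.\<close>
  define B where "B i j =
     (if i = 0 then (if j = 0 then c * p^2 else if j = 1 then 2 * c * p * q else c * q^2)
      else if i = 1 then (if j = 0 then 2 * c * p * r else if j = 1 then 2 * c * (p * s + q * r) else 2 * c * q * s)
      else (if j = 0 then c * r^2 else if j = 1 then 2 * c * r * s else c * s^2))" for i j :: nat
  have "biquadratic ?A x1 x2 y1 y2 = biquadratic B x1 x2 y1 y2" for x1 x2 y1 y2
    unfolding sq by (simp add: biquadratic_expand B_def algebra_simps power2_eq_square)
  then have AB: "?A i j = B i j" if "i \<le> 2" "j \<le> 2" for i j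
    using that biquadratic_eqD by blast
  define L :: "'a bipoly" where "L = mconst p * mvar (Inl 1) * mvar (Inr 1) + mconst q * mvar (Inl 1) * mvar (Inr 2)
    + mconst r * mvar (Inl 2) * mvar (Inr 1) + mconst s * mvar (Inl 2) * mvar (Inr 2)"
  have "F = biquadratic (\<lambda>i j. mconst (?A i j))
    (mvar (Inl 1)) (mvar (Inl 2)) (mvar (Inr 1)) (mvar (Inr 2))"
    by (rule bihomogeneous_eq_biquadratic[OF F])
  also have "\<dots> = (mconst c * L) * L"
    by (simp add: biquadratic_expand AB) (simp add: B_def L_def mconst_arith algebra_simps power2_eq_square)
  finally have "F = (mconst c * L) * L" .
  moreover have "\<not> L dvd 1" "\<not> mconst c * L dvd 1"
    by (rule not_unit_of_lookup_zero; simp add: L_def lookup_times_zero lookup_add)+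
  ultimately show False using irr by (auto dest: irreducibleD)
qed

lemma irreducible_no_linear_factor:
  fixes F :: "'a::field bipoly"
  assumes irr: "irreducible F" and F: "bihomogeneous 2 2 F" and z: "(z1, z2) \<noteq> (0, 0)"
  shows "\<exists>u v. biquadratic (bi_coeff F) u v z1 z2 \<noteq> 0" "\<exists>u v. biquadratic (bi_coeff F) z1 z2 u v \<noteq> 0"
proof -
  let ?X1 = "mvar (Inl 1) :: 'a bipoly" and ?X2 = "mvar (Inl 2) :: 'a bipoly"
  let ?Y1 = "mvar (Inr 1) :: 'a bipoly" and ?Y2 = "mvar (Inr 2) :: 'a bipoly"
  have irr': "irreducible (biquadratic (\<lambda>i j. mconst (bi_coeff F i j))
    ?X1 ?X2 ?Y1 ?Y2)"
    using irr bihomogeneous_eq_biquadratic[OF F] by simp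
  then show "\<exists>u v. biquadratic (bi_coeff F) u v z1 z2 \<noteq> 0"
    by (rule irreducible_biquadratic_nonvanishing) (use z in simp_all)
  have "irreducible (biquadratic (\<lambda>i j. mconst (transposed (bi_coeff F) i j))
    ?Y1 ?Y2 ?X1 ?X2)"
  proof -
    have "(\<lambda>i j. mconst (transposed (bi_coeff F) i j) :: 'a bipoly) = transposed (\<lambda>i j. mconst (bi_coeff F i j))"
      by (simp add: transposed_def fun_eq_iff)
    then show ?thesis using irr' by (simp add: biquadratic_transposed)
  qed
  then have "\<exists>u v. biquadratic (transposed (bi_coeff F)) u v z1 z2 \<noteq> 0"
    by (rule irreducible_biquadratic_nonvanishing) (use z in simp_all)
  then show "\<exists>u v. biquadratic (bi_coeff F) z1 z2 u v \<noteq> 0" by (simp add: biquadratic_transposed)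
qed


section \<open>Nonsingular curves and automorphisms of the line\<close>


lemma biquadratic_scale:
  "biquadratic A (c * x1) (c * x2) (d * y1) (d * y2) = c^2 * d^2 * biquadratic A x1 x2 y1 y2"
  by (simp add: biquadratic_expand algebra_simps power2_eq_square)

lemma vec2_eq_0_iff: "(x :: 'a::zero ^ 2) = 0 \<longleftrightarrow> x $ 1 = 0 \<and> x $ 2 = 0"
  by (simp add: vec_eq_iff forall_2)

lemma p1_pt_scale:
  assumes "c \<noteq> 0" "x \<noteq> 0"
  shows "p1_pt (c *s x) = p1_pt x"
proof -
  have "c *s x \<noteq> 0" using assms by (simp add: vec_eq_iff)
  then show ?thesis using p1_pt_eq_iff[OF assms(2)] assms(1) by metis
qed

lemma mem_biproj_zeros_iff:
  fixes F :: "'a::field bipoly" and x y :: "'a ^ 2"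
  assumes F: "bihomogeneous 2 2 F" and nz: "x \<noteq> 0" "y \<noteq> 0"
  shows "(p1_pt x, p1_pt y) \<in> biproj_zeros F \<longleftrightarrow>
    biquadratic (bi_coeff F) (x $ 1) (x $ 2) (y $ 1) (y $ 2) = 0"
proof
  assume "(p1_pt x, p1_pt y) \<in> biproj_zeros F"
  then obtain x' y' :: "'a ^ 2" where 1: "x' \<noteq> 0" "y' \<noteq> 0" "p1_pt x = p1_pt x'" "p1_pt y = p1_pt y'"
    "biquadratic (bi_coeff F) (x' $ 1) (x' $ 2) (y' $ 1) (y' $ 2) = 0"
    unfolding biproj_zeros_def bipoly_eval_bihomogeneous[OF F] by auto
  obtain c d where "c \<noteq> 0" "d \<noteq> 0" "x' = c *s x" "y' = d *s y"
    using 1 nz p1_pt_eq_iff by metis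
  with 1(5) show "biquadratic (bi_coeff F) (x $ 1) (x $ 2) (y $ 1) (y $ 2) = 0"
    by (simp add: biquadratic_scale)
next
  assume "biquadratic (bi_coeff F) (x $ 1) (x $ 2) (y $ 1) (y $ 2) = 0"
  with nz show "(p1_pt x, p1_pt y) \<in> biproj_zeros F"
    unfolding biproj_zeros_def bipoly_eval_bihomogeneous[OF F] by blast
qed

lemma exists_transversal:
  fixes x :: "'a::field ^ 2"
  assumes "x \<noteq> 0"
  obtains u :: "'a ^ 2" where "x $ 1 * u $ 2 - u $ 1 * x $ 2 \<noteq> 0"
proof (cases "x $ 1 = 0")
  case True
  then show thesis using assms that[of "vector [1, 0]"] by (simp add: vec2_eq_0_iff)
next
  case False
  then show thesis using that[of "vector [0, 1]"] by simp
qed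

text \<open>Each partial derivative of \<open>G\<close> is a linear coefficient along a coordinate
  line. If the direction is transversal to the point, the line lies in a plane covered by
  \<open>vanishing_second_order\<close>; otherwise it stays in the cone over the point, where
  \<open>G\<close> vanishes.\<close>

lemma bipoly_gradient_singular:
  fixes F :: "'a::alg_closed_field bipoly" and x y :: "'a ^ 2"
  assumes two: "(2::'a) \<noteq> 0" and irr: "irreducible F" and F: "bihomogeneous 2 2 F"
    and x: "x \<noteq> 0" and y: "y \<noteq> 0"
    and sing: "singular_at (bi_coeff F) (x $ 1) (x $ 2) (y $ 1) (y $ 2)"
    and G: "G \<in> vanishing_ideal (biproj_zeros F)"
  shows "bipoly_gradient G x y = 0"
proof -
  let ?A = "bi_coeff F"
  let ?z = "case_sum (($) x) (($) y)"
  have van: "bipoly_eval G X Y = 0"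
    if "X \<noteq> 0" "Y \<noteq> 0" "biquadratic ?A (X $ 1) (X $ 2) (Y $ 1) (Y $ 2) = 0" for X Y :: "'a ^ 2"
    using G that mem_biproj_zeros_iff[OF F that(1,2)] unfolding vanishing_ideal_def by blast
  have nz: "X + s *s U \<noteq> 0" if "X $ 1 * U $ 2 - U $ 1 * X $ 2 \<noteq> 0" for X U :: "'a ^ 2" and s
  proof
    assume "X + s *s U = 0"
    then have "X $ 1 = - (s * U $ 1)" "X $ 2 = - (s * U $ 2)"
      by (simp_all add: vec2_eq_0_iff eq_neg_iff_add_eq_0)
    with that show False by simp
  qed
  have nzi: "X + s *s axis i 1 \<noteq> 0" if "poly [:X $ i, 1:] s \<noteq> 0" for X :: "'a ^ 2" and s i
  proof
    assume "X + s *s axis i 1 = 0"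
    then have "(X + s *s axis i 1) $ i = 0" by simp
    with that show False by simp
  qed
  obtain c c' where c: "\<And>u v. biquadratic ?A u v (y $ 1) (y $ 2) = c * (u * x $ 2 - v * x $ 1)^2"
    and c': "\<And>u v. biquadratic ?A (x $ 1) (x $ 2) u v = c' * (u * y $ 2 - v * y $ 1)^2"
    using sing unfolding singular_at_def by blast
  have plane: "\<exists>g. (\<forall>s t. poly (poly g [:s:]) t = bipoly_eval G (x + s *s u) (y + t *s w)) \<and>
      coeff (coeff g 0) 1 = 0 \<and> coeff (coeff g 1) 0 = 0"
    if u: "x $ 1 * u $ 2 - u $ 1 * x $ 2 \<noteq> 0" and w: "y $ 1 * w $ 2 - w $ 1 * y $ 2 \<noteq> 0" for u w :: "'a ^ 2"
  proof -
    obtain g where g: "\<And>s t. poly (poly g [:s:]) t = mpoly_eval G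
        (\<lambda>v. ?z v + s * case_sum (($) u) (\<lambda>_. 0) v + t * case_sum (\<lambda>_. 0) (($) w) v)"
      using mpoly_eval_plane[of G ?z "case_sum (($) u) (\<lambda>_. 0)" "case_sum (\<lambda>_. 0) (($) w)"] by blast
    have ev: "poly (poly g [:s:]) t = bipoly_eval G (x + s *s u) (y + t *s w)" for s t
      unfolding g bipoly_eval_def by (rule arg_cong[of _ _ "mpoly_eval G"]) (auto simp: fun_eq_iff split: sum.splits)
    have "poly (poly g [:s:]) t = 0"
      if "biquadratic ?A (x $ 1 + u $ 1 * s) (x $ 2 + u $ 2 * s) (y $ 1 + w $ 1 * t) (y $ 2 + w $ 2 * t) = 0" for s t
      unfolding ev by (rule van) (use that nz[OF u] nz[OF w] in \<open>simp_all add: mult.commute\<close>)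
    then have "coeff (coeff g 0) 1 = 0" "coeff (coeff g 1) 0 = 0"
      using vanishing_second_order[OF two irreducible_not_square_form[OF irr F] sing _ _ u w, of g]
        irreducible_no_linear_factor[OF irr F] x y by (simp_all add: vec2_eq_0_iff)
    with ev show ?thesis by blast
  qed
  have "bipoly_eval (mpoly_deriv v G) x y = 0" for v
  proof -
    obtain P where P: "\<And>s. poly P s = mpoly_eval G (?z(v := ?z v + s))"
      and dP: "coeff P 1 = mpoly_eval (mpoly_deriv v G) ?z"
      using mpoly_eval_axis_line[of G ?z v] by blast
    have "coeff P 1 = 0"
    proof (cases v)
      case (Inl i)
      have P': "poly P s = bipoly_eval G (x + s *s axis i 1) y" for s
        unfolding P bipoly_eval_def Inl
        by (rule arg_cong[of _ _ "mpoly_eval G"]) (auto simp: fun_eq_iff axis_def split: sum.splits)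
      show ?thesis
      proof (cases "x $ 1 * axis i 1 $ 2 - axis i 1 $ 1 * x $ 2 = 0")
        case True
        \<comment> \<open>The line consists of multiples of \<open>x\<close> and passes through zero
          at \<open>s = - x $ i\<close>, the one value left out.\<close>
        have "poly P s = 0" if "poly [:x $ i, 1:] s \<noteq> 0" for s
          unfolding P'
        proof (rule van[OF nzi[OF that] y])
          have "(x $ 1 + s * axis i 1 $ 1) * x $ 2 - (x $ 2 + s * axis i 1 $ 2) * x $ 1 =
              - (s * (x $ 1 * axis i 1 $ 2 - axis i 1 $ 1 * x $ 2))"
            by (simp add: algebra_simps)
          then show "biquadratic ?A ((x + s *s axis i 1) $ 1) ((x + s *s axis i 1) $ 2) (y $ 1) (y $ 2) = 0"
            by (simp add: c True)
        qed
        then have "P = 0" by (rule poly_eq_0_of_cofinite_roots[of "[:x $ i, 1:]"]) simp_all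
        then show ?thesis by simp
      next
        case False
        \<comment> \<open>Any transversal \<open>w\<close> completes the line to a plane; the line
          is recovered at \<open>t = 0\<close>.\<close>
        obtain w :: "'a ^ 2" where "y $ 1 * w $ 2 - w $ 1 * y $ 2 \<noteq> 0" using exists_transversal[OF y] .
        then obtain g where g: "\<And>s t. poly (poly g [:s:]) t = bipoly_eval G (x + s *s axis i 1) (y + t *s w)"
          "coeff (coeff g 1) 0 = 0" using plane[OF False] by blast
        obtain h where h: "\<And>s. poly h s = poly (poly g [:s:]) 0" "coeff h 1 = coeff (coeff g 1) 0"
          using poly_restrict_fst[of g] by blast
        have "P = h" by (rule poly_eqI_alg_closed) (simp add: P' h g)
        then show ?thesis using h g by simp
      qed
    next
      case (Inr j)
      have P': "poly P s = bipoly_eval G x (y + s *s axis j 1)" for s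
        unfolding P bipoly_eval_def Inr
        by (rule arg_cong[of _ _ "mpoly_eval G"]) (auto simp: fun_eq_iff axis_def split: sum.splits)
      show ?thesis
      proof (cases "y $ 1 * axis j 1 $ 2 - axis j 1 $ 1 * y $ 2 = 0")
        case True
        have "poly P s = 0" if "poly [:y $ j, 1:] s \<noteq> 0" for s
          unfolding P'
        proof (rule van[OF x nzi[OF that]])
          have "(y $ 1 + s * axis j 1 $ 1) * y $ 2 - (y $ 2 + s * axis j 1 $ 2) * y $ 1 =
              - (s * (y $ 1 * axis j 1 $ 2 - axis j 1 $ 1 * y $ 2))"
            by (simp add: algebra_simps)
          then show "biquadratic ?A (x $ 1) (x $ 2) ((y + s *s axis j 1) $ 1) ((y + s *s axis j 1) $ 2) = 0"
            by (simp add: c' True)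
        qed
        then have "P = 0" by (rule poly_eq_0_of_cofinite_roots[of "[:y $ j, 1:]"]) simp_all
        then show ?thesis by simp
      next
        case False
        obtain u :: "'a ^ 2" where "x $ 1 * u $ 2 - u $ 1 * x $ 2 \<noteq> 0" using exists_transversal[OF x] .
        then obtain g where g: "\<And>s t. poly (poly g [:s:]) t = bipoly_eval G (x + s *s u) (y + t *s axis j 1)"
          "coeff (coeff g 0) 1 = 0" using plane[OF _ False] by blast
        have "P = coeff g 0"
        proof (rule poly_eqI_alg_closed)
          fix t show "poly P t = poly (coeff g 0) t"
            using g(1)[of 0 t] by (simp add: P' poly_0_coeff_0)
        qed
        then show ?thesis using g by simp
      qed
    qed
    then show ?thesis using dP by (simp add: bipoly_eval_def)
  qed
  then show ?thesis by (simp add: bipoly_gradient_def vec_eq_iff)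
qed

text \<open>At a singular point of the form all gradients from the vanishing ideal are zero, so they
  span dimension 0 instead of 1.\<close>

lemma nonsingular_imp_smooth:
  fixes F :: "'a::alg_closed_field bipoly"
  assumes two: "(2::'a) \<noteq> 0" and irr: "irreducible F" and F: "bihomogeneous 2 2 F"
    and ns: "nonsingular_curve (biproj_zeros F)"
  shows "smooth (bi_coeff F)"
  unfolding smooth_def
proof (intro conjI allI impI)
  fix x1 x2 y1 y2 :: 'a
  assume nz: "(x1, x2) \<noteq> (0, 0)" "(y1, y2) \<noteq> (0, 0)"
  show "\<not> singular_at (bi_coeff F) x1 x2 y1 y2"
  proof
    assume sing: "singular_at (bi_coeff F) x1 x2 y1 y2"
    define x y :: "'a ^ 2" where "x = vector [x1, x2]" and "y = vector [y1, y2]"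
    have xy: "x $ 1 = x1" "x $ 2 = x2" "y $ 1 = y1" "y $ 2 = y2" by (simp_all add: x_def y_def)
    have x: "x \<noteq> 0" and y: "y \<noteq> 0" using nz xy by (auto simp: vec2_eq_0_iff)
    \<comment> \<open>Taking \<open>(u, v) = (x1, x2)\<close> shows that the singular point lies on
      the curve.\<close>
    obtain c where "\<And>u v. biquadratic (bi_coeff F) u v y1 y2 = c * (u * x2 - v * x1)^2"
      using sing unfolding singular_at_def by blast
    then have "(p1_pt x, p1_pt y) \<in> biproj_zeros F"
      using mem_biproj_zeros_iff[OF F x y] xy by (simp add: mult.commute)
    then have "vec.dim {bipoly_gradient G x y | G. G \<in> vanishing_ideal (biproj_zeros F)} = 1"
      using ns x y unfolding nonsingular_curve_def by blast
    moreover have "{bipoly_gradient G x y | G. G \<in> vanishing_ideal (biproj_zeros F)} \<subseteq> {0}"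
      using bipoly_gradient_singular[OF two irr F x y] sing xy by auto
    then have "vec.dim {bipoly_gradient G x y | G. G \<in> vanishing_ideal (biproj_zeros F)} \<le> card ({} :: ('a ^ (2 + 2)) set)"
      by (intro vec.dim_le_card) (auto simp: vec.span_empty)
    ultimately show False by simp
  qed
qed (use irreducible_no_linear_factor[OF irr F] in blast)+

section \<open>Projective linear automorphisms of the line\<close>

definition p1_linear :: "'a::field \<Rightarrow> 'a \<Rightarrow> 'a \<Rightarrow> 'a \<Rightarrow> 'a p1 \<Rightarrow> 'a p1" where
  "p1_linear e f g h p = (let x = (SOME x. x \<noteq> 0 \<and> p = p1_pt x)
     in p1_pt (vector [e * x $ 1 + f * x $ 2, g * x $ 1 + h * x $ 2]))"

lemma linear_nonzero:
  fixes e f g h :: "'a::field" and x :: "'a ^ 2"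
  assumes "e * h - f * g \<noteq> 0" "x \<noteq> 0"
  shows "(vector [e * x $ 1 + f * x $ 2, g * x $ 1 + h * x $ 2] :: 'a ^ 2) \<noteq> 0"
  using linear_kernel[OF assms(1), of "x $ 1" "x $ 2"] assms(2) by (auto simp: vec2_eq_0_iff)

text \<open>The chosen representative differs from \<open>x\<close> by a scalar, which the linear
  map passes on; hence the choice does not affect the image point.\<close>

lemma p1_linear_pt:
  fixes e f g h :: "'a::field" and x :: "'a ^ 2"
  assumes d: "e * h - f * g \<noteq> 0" and x: "x \<noteq> 0"
  shows "p1_linear e f g h (p1_pt x) = p1_pt (vector [e * x $ 1 + f * x $ 2, g * x $ 1 + h * x $ 2])"
proof -
  define x' where "x' = (SOME x'. x' \<noteq> 0 \<and> p1_pt x = p1_pt x')"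
  have x': "x' \<noteq> 0" "p1_pt x = p1_pt x'"
    using someI[of "\<lambda>x'. x' \<noteq> 0 \<and> p1_pt x = p1_pt x'" x] x unfolding x'_def by auto
  then obtain c where c: "c \<noteq> 0" "x' = c *s x" using p1_pt_eq_iff x by blast
  have "(vector [e * x' $ 1 + f * x' $ 2, g * x' $ 1 + h * x' $ 2] :: 'a ^ 2) =
      c *s vector [e * x $ 1 + f * x $ 2, g * x $ 1 + h * x $ 2]"
    by (simp add: c vec_eq_iff forall_2 algebra_simps)
  then show ?thesis
    unfolding p1_linear_def Let_def x'_def[symmetric]
    using p1_pt_eq_iff[OF linear_nonzero[OF d x] linear_nonzero[OF d x'(1)]] c(1) by metis
qed

lemma p1_morphism_linear:
  fixes e f g h :: "'a::field"
  assumes d: "e * h - f * g \<noteq> 0"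
  shows "p1_morphism (p1_linear e f g h)"
proof -
  define form :: "'a \<Rightarrow> 'a \<Rightarrow> (2, 'a) mpoly" where
    "form a b = Poly_Mapping.single (Poly_Mapping.single 1 1) a + Poly_Mapping.single (Poly_Mapping.single 2 1) b" for a b
  have hom: "homogeneous 1 (form a b)" for a b
    unfolding homogeneous_def
  proof
    fix m assume "m \<in> Poly_Mapping.keys (form a b)"
    then have "m \<in> {Poly_Mapping.single 1 1, Poly_Mapping.single 2 1}"
      using Poly_Mapping.keys_add[of "Poly_Mapping.single (Poly_Mapping.single 1 1) a"
          "Poly_Mapping.single (Poly_Mapping.single (2::2) 1) b"]
      unfolding form_def by (auto split: if_splits)
    then show "(\<Sum>v\<in>UNIV. Poly_Mapping.lookup m v) = 1"
      by (auto simp: sum_2 lookup_single)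
  qed
  have ev: "mpoly_eval (form a b) (($) x) = a * x $ 1 + b * x $ 2" for a b x
    by (simp add: form_def mpoly_eval_add mpoly_eval_single UNIV_2 lookup_single)
  show ?thesis
    unfolding p1_morphism_def
    by (intro exI[of _ 1] exI[of _ "form e f"] exI[of _ "form g h"])
      (simp add: hom ev p1_linear_pt[OF d] linear_nonzero[OF d])
qed

text \<open>The outer matrix is the adjugate of the inner one, so their product is a nonzero scalar
  and acts trivially on points.\<close>

lemma p1_linear_inverse:
  fixes e f g h :: "'a::field"
  assumes d: "e * h - f * g \<noteq> 0"
  shows "p1_linear h (- f) (- g) e (p1_linear e f g h p) = p"
proof -
  obtain x where x: "x \<noteq> 0" "p = p1_pt x" by (rule p1_pt_cases)
  have d': "h * e - (- f) * (- g) \<noteq> 0" using d by (simp add: mult.commute)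
  let ?y = "vector [e * x $ 1 + f * x $ 2, g * x $ 1 + h * x $ 2] :: 'a ^ 2"
  have "vector [h * ?y $ 1 + (- f) * ?y $ 2, (- g) * ?y $ 1 + e * ?y $ 2] = (e * h - f * g) *s x"
    by (simp add: vec_eq_iff forall_2 algebra_simps)
  moreover have "p1_pt ((e * h - f * g) *s x) = p1_pt x"
    using p1_pt_scale[OF d x(1)] .
  ultimately show ?thesis
    unfolding x(2) p1_linear_pt[OF d x(1)] p1_linear_pt[OF d' linear_nonzero[OF d x(1)]] by simp
qed

lemma p1_automorphism_linear:
  fixes e f g h :: "'a::field"
  assumes d: "e * h - f * g \<noteq> 0"
  shows "p1_automorphism (p1_linear e f g h)"
proof -
  have d': "h * e - (- f) * (- g) \<noteq> 0" using d by (simp add: mult.commute)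
  have inv: "p1_linear e f g h (p1_linear h (- f) (- g) e p) = p" for p
    using p1_linear_inverse[OF d'] by simp
  have "bij (p1_linear e f g h)"
    by (rule bij_betw_byWitness[of _ "p1_linear h (- f) (- g) e"])
      (simp_all add: p1_linear_inverse[OF d] inv)
  moreover have "inv (p1_linear e f g h) = p1_linear h (- f) (- g) e"
    by (rule inv_equality) (simp_all add: p1_linear_inverse[OF d] inv)
  ultimately show ?thesis
    unfolding p1_automorphism_def using p1_morphism_linear[OF d] p1_morphism_linear[OF d'] by simp
qed

theorem theorem4p1:
  fixes F :: "'a::alg_closed_field bipoly"
    and E :: "('a p1 \<times> 'a p1) set"
  assumes "CHAR('a) \<noteq> 2"
    and "irreducible F"
    and "bihomogeneous 2 2 F"
    and "E = biproj_zeros F"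
    and "nonsingular_curve E"
  shows "\<exists>f. p1_automorphism f \<and> sym (map_prod f id ` E)"
proof -
  let ?A = "bi_coeff F"
  have two: "(2::'a) \<noteq> 0"
  proof
    assume "(2::'a) = 0"
    then have "CHAR('a) dvd 2"
      using of_nat_eq_0_iff_char_dvd[of 2, where 'a = 'a] by simp
    \<comment> \<open>A divisor of the prime \<open>2\<close> other than \<open>2\<close> would be
      \<open>1\<close>, which is not a characteristic of a field.\<close>
    then show False
      using assms(1) CHAR_not_1[where 'a = 'a] prime_nat_iff[of 2] two_is_prime_nat One_nat_def by metis
  qed
  have "symmetrizable ?A"
    using nonsingular_imp_smooth[OF two assms(2,3)] assms(4,5) smooth_imp_symmetrizable[OF two] by blast
  then obtain e f g h e' f' g' h' where d: "e * h - f * g \<noteq> 0" and d': "e' * h' - f' * g' \<noteq> 0"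
    and symm: "\<And>x1 x2 y1 y2.
        biquadratic ?A (e * x1 + f * x2) (g * x1 + h * x2) (e' * y1 + f' * y2) (g' * y1 + h' * y2) =
        biquadratic ?A (e * y1 + f * y2) (g * y1 + h * y2) (e' * x1 + f' * x2) (g' * x1 + h' * x2)"
    unfolding symmetrizable_def by blast
  define M N where "M x = (vector [e * x $ 1 + f * x $ 2, g * x $ 1 + h * x $ 2] :: 'a ^ 2)"
    and "N x = (vector [e' * x $ 1 + f' * x $ 2, g' * x $ 1 + h' * x $ 2] :: 'a ^ 2)" for x :: "'a ^ 2"
  have M0: "M x \<noteq> 0" and N0: "N x \<noteq> 0" if "x \<noteq> 0" for x
    using linear_nonzero[OF d that] linear_nonzero[OF d' that] by (simp_all add: M_def N_def)
  have E: "(p1_pt (M x), p1_pt (N y)) \<in> E \<longleftrightarrow> (p1_pt (M y), p1_pt (N x)) \<in> E" if "x \<noteq> 0" "y \<noteq> 0" for x y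
    unfolding assms(4) mem_biproj_zeros_iff[OF assms(3) M0[OF that(1)] N0[OF that(2)]]
      mem_biproj_zeros_iff[OF assms(3) M0[OF that(2)] N0[OF that(1)]]
    by (simp add: M_def N_def symm)
  \<comment> \<open>the matrix is \<open>N\<close> times the adjugate of \<open>M\<close>\<close>
  define \<phi> where "\<phi> = p1_linear (e' * h - f' * g) (f' * e - e' * f) (g' * h - h' * g) (h' * e - g' * f)"
  have "(e' * h - f' * g) * (h' * e - g' * f) - (f' * e - e' * f) * (g' * h - h' * g) =
      (e * h - f * g) * (e' * h' - f' * g')"
    by (simp add: algebra_simps)
  with d d' have det: "(e' * h - f' * g) * (h' * e - g' * f) - (f' * e - e' * f) * (g' * h - h' * g) \<noteq> 0"
    by simp
  have \<phi>: "\<phi> (p1_pt (M x)) = p1_pt (N x)" if "x \<noteq> 0" for x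
  proof -
    have "vector [(e' * h - f' * g) * M x $ 1 + (f' * e - e' * f) * M x $ 2,
        (g' * h - h' * g) * M x $ 1 + (h' * e - g' * f) * M x $ 2] = (e * h - f * g) *s N x"
      by (simp add: M_def N_def vec_eq_iff forall_2 algebra_simps)
    moreover have "p1_pt ((e * h - f * g) *s N x) = p1_pt (N x)"
      using p1_pt_scale[OF d N0[OF that]] .
    ultimately show ?thesis unfolding \<phi>_def p1_linear_pt[OF det M0[OF that]] by simp
  qed
  have onto: "\<exists>x. x \<noteq> 0 \<and> p = p1_pt (M x)" "\<exists>x. x \<noteq> 0 \<and> p = p1_pt (N x)" for p
  proof -
    obtain y where y: "y \<noteq> 0" "p = p1_pt y" by (rule p1_pt_cases)
    have lift: "\<exists>x :: 'a ^ 2. x \<noteq> 0 \<and> y = vector [a * x $ 1 + b * x $ 2, c * x $ 1 + d * x $ 2]"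
      if nz: "a * d - b * c \<noteq> 0" for a b c d
    proof -
      define D where "D = a * d - b * c"
      let ?x = "vector [(d * y $ 1 - b * y $ 2) / D, (a * y $ 2 - c * y $ 1) / D] :: 'a ^ 2"
      have eq: "y = vector [a * ?x $ 1 + b * ?x $ 2, c * ?x $ 1 + d * ?x $ 2]"
        using linear_inverse[OF nz, of "y $ 1" "y $ 2"] by (simp add: D_def vec_eq_iff forall_2)
      moreover have "?x \<noteq> 0"
      proof
        assume "?x = 0"
        then have "y = 0" using eq by (simp only: vec2_eq_0_iff) simp
        with y(1) show False by simp
      qed
      ultimately show ?thesis by blast
    qed
    show "\<exists>x. x \<noteq> 0 \<and> p = p1_pt (M x)" "\<exists>x. x \<noteq> 0 \<and> p = p1_pt (N x)"
      unfolding y(2) M_def N_def using lift[OF d] lift[OF d'] by metis+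
  qed
  \<comment> \<open>As \<open>\<phi>\<close> takes \<open>M x\<close> to \<open>N x\<close>, the new
    curve consists of the points \<open>(N x, N y)\<close> with \<open>(M x, N y)\<close> on the old
    one. By the fact \<open>E\<close> this condition is symmetric in \<open>x\<close> and
    \<open>y\<close>.\<close>
  have "sym (map_prod \<phi> id ` E)"
  proof (rule symI)
    fix a b assume "(a, b) \<in> map_prod \<phi> id ` E"
    then obtain p where p: "(p, b) \<in> E" "a = \<phi> p" by auto
    obtain x where x: "x \<noteq> 0" "p = p1_pt (M x)" using onto(1) by blast
    obtain y where y: "y \<noteq> 0" "b = p1_pt (N y)" using onto(2) by blast
    have "(p1_pt (M y), p1_pt (N x)) \<in> E" using p(1) E[OF x(1) y(1)] x(2) y(2) by simp
    then have "(\<phi> (p1_pt (M y)), p1_pt (N x)) \<in> map_prod \<phi> id ` E" by force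
    then show "(b, a) \<in> map_prod \<phi> id ` E" using \<phi> x y p(2) by simp
  qed
  with p1_automorphism_linear[OF det] show ?thesis unfolding \<phi>_def by blast
qed

end
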